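(* Assume the following conjecture holds: whenever $k,t$ are functions of $m\in\mathbb N$ (with $k(m)$ a positive integer and $t(m)$ a positive real) such that $\lim_{m\to\infty}k(m)/m=0$, $\lim_{m\to\infty}k(m)=\infty$ and $\lim_{m\to\infty}t(m)/\sqrt{k(m)}=\infty$, then $$\lim_{m\to\infty}\frac{\sqrt{N_1(2m,m,k(m),t(m))}}{\binom{2m}{m}}=0.$$ Let $f:\mathbb N\to\mathbb N$ with $f(n)\ge 2$ for all $n$, and let $\mathcal A\subseteq\mathbb T(f)$ be an analytic family of infinitely branching trees such that the poset $(\mathcal A,\subseteq)$ is weakly distributive and satisfies the countable chain condition, and such that $\mathcal A$ has locally bounded branching decay for $x^{<1}$. Then there exist a colouring $c:\mathrm{seq}(f)\to\{0,1\}$ and a tree $T\in\mathcal A$ such that for every $S\in\mathcal A$ with $S\subseteq T$, the level $S(n)$ is nonhomogeneous for $c$ for all but finitely many $n\in\mathbb N$.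
   Context: $\mathbb N=\{0,1,2,\dots\}$. For $n\in\mathbb N$, $[n]=\{1,\dots,n\}$. For a family $\mathcal X$ of subsets of $[n]$ and $m\le n$, the $m$-shade is $\nabla_m(\mathcal X)=\{y\subseteq[n]:|y|=m,\ x\subseteq y\text{ for some }x\in\mathcal X\}$. A pair $(\mathcal A',\mathcal B')$ of families of subsets of $[n]$ is cross-$t$-intersecting if $|E\cap F|\ge t$ for all $E\in\mathcal A'$, $F\in\mathcal B'$. $N_1(n,m,k,t)$ is the maximum of $|\nabla_m(\mathcal A')|\cdot|\nabla_m(\mathcal B')|$ over all cross-$t$-intersecting pairs $(\mathcal A',\mathcal B')$ with $\mathcal A',\mathcal B'\subseteq\binom{[n]}{k}$ (families of $k$-element subsets of $[n]$). For $f:\mathbb N\to\mathbb N$ with $f\ge 2$, $\mathrm{seq}(f)=\bigcup_{n}\prod_{i<n}\{0,\dots,f(i)-1\}$ is the tree of finite sequences $t$ with domain $\{0,\dots,n-1\}$ and $t(i)<f(i)$, ordered by inclusion; $\mathbb T(f)$ is the set of all subtrees (downward closed subsets) of $\mathrm{seq}(f)$, topologized as a subspace of $\{0,1\}^{\mathrm{seq}(f)}$ (so "analytic" refers to this Polish topology). For $T\in\mathbb T(f)$, $T(n)$ is the set of elements of $T$ of length $n$, and $h_T(n)=|T(n)|$. A branch is an infinite downward closed chain; $T$ is infinitely branching if it has infinitely many branches. A set $A\subseteq\mathrm{seq}(f)$ is homogeneous for $c:\mathrm{seq}(f)\to\{0,1\}$ if $c$ is constant on $A$, nonhomogeneous otherwise.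 An antichain in $(\mathcal A,\subseteq)$ is a set of pairwise incompatible elements, where $S,S'$ are incompatible if no $U\in\mathcal A$ satisfies $U\subseteq S$ and $U\subseteq S'$; ccc means every antichain is countable. Weakly distributive means forcing with $(\mathcal A,\subseteq)$ adds no real in $\mathbb N^{\mathbb N}$ unbounded over the ground model reals (in the eventual domination order). $\mathcal A$ has locally bounded branching decay for $x^{<1}$ if there is $T\in\mathcal A$ such that for every $S\in\mathcal A$ with $S\subseteq T$ and every $0<\alpha<1$, $\liminf_{n\to\infty} h_S(n)/h_T(n)^{\alpha}>0$. *)

theory Defs
  imports "HOL-Analysis.Analysis" "HOL-Library.Sublist"
begin

subsection \<open>Shades and cross-intersecting families\<close>

definition k_subsets :: "nat \<Rightarrow> nat \<Rightarrow> nat set set" where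
  "k_subsets n k = {x. x \<subseteq> {1..n} \<and> card x = k}"

definition shade :: "nat \<Rightarrow> nat \<Rightarrow> nat set set \<Rightarrow> nat set set" where
  "shade n m X = {y \<in> k_subsets n m. \<exists>x\<in>X. x \<subseteq> y}"

definition cross_intersecting :: "real \<Rightarrow> nat set set \<Rightarrow> nat set set \<Rightarrow> bool" where
  "cross_intersecting t X Y \<longleftrightarrow> (\<forall>E\<in>X. \<forall>F\<in>Y. real (card (E \<inter> F)) \<ge> t)"

definition shade_products :: "nat \<Rightarrow> nat \<Rightarrow> nat \<Rightarrow> real \<Rightarrow> nat set" where
  "shade_products n m k t =
     {card (shade n m X) * card (shade n m Y) | X Y.
        X \<subseteq> k_subsets n k \<and> Y \<subseteq> k_subsets n k \<and> cross_intersecting t X Y}"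

definition N1 :: "nat \<Rightarrow> nat \<Rightarrow> nat \<Rightarrow> real \<Rightarrow> nat" where
  "N1 n m k t = Max (shade_products n m k t)"

text \<open>The maximum is taken over a finite nonempty set, so it is attained.\<close>

lemma finite_k_subsets: "finite (k_subsets n k)"
  by (rule finite_subset[of _ "Pow {1..n}"]) (auto simp: k_subsets_def)

lemma finite_shade_products: "finite (shade_products n m k t)"
proof (rule finite_subset)
  show "shade_products n m k t \<subseteq>
      (\<lambda>(X, Y). card (shade n m X) * card (shade n m Y)) ` (Pow (k_subsets n k) \<times> Pow (k_subsets n k))"
    by (auto simp: shade_products_def)
qed (simp add: finite_k_subsets)

lemma shade_products_nonempty: "shade_products n m k t \<noteq> {}"
proof -
  have "card (shade n m {}) * card (shade n m {}) \<in> shade_products n m k t"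
    unfolding shade_products_def cross_intersecting_def by blast
  then show ?thesis by blast
qed


subsection \<open>Trees\<close>

text \<open>A finite sequence with domain \<open>{0, \<dots>, n - 1}\<close> is a list of length \<open>n\<close>; inclusion of
  sequences is the prefix order.\<close>

definition seq :: "(nat \<Rightarrow> nat) \<Rightarrow> nat list set" where
  "seq f = {s. \<forall>i<length s. s ! i < f i}"

definition down_closed :: "nat list set \<Rightarrow> bool" where
  "down_closed T \<longleftrightarrow> (\<forall>s\<in>T. \<forall>r. prefix r s \<longrightarrow> r \<in> T)"

definition trees :: "(nat \<Rightarrow> nat) \<Rightarrow> nat list set set" where
  "trees f = {T. T \<subseteq> seq f \<and> down_closed T}"

definition level :: "nat list set \<Rightarrow> nat \<Rightarrow> nat list set" where
  "level T n = {s \<in> T. length s = n}"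

definition height_fun :: "nat list set \<Rightarrow> nat \<Rightarrow> nat" where
  "height_fun T n = card (level T n)"

definition branches :: "nat list set \<Rightarrow> nat list set set" where
  "branches T = {B. B \<subseteq> T \<and> infinite B \<and> down_closed B \<and> Complete_Partial_Order.chain prefix B}"

definition infinitely_branching :: "nat list set \<Rightarrow> bool" where
  "infinitely_branching T \<longleftrightarrow> infinite (branches T)"

text \<open>The subspace topology inherited from \<open>{0, 1}\<close> to the power \<open>seq f\<close>, a tree being identified
  with its characteristic function.\<close>

definition tree_topology :: "(nat \<Rightarrow> nat) \<Rightarrow> nat list set topology" where
  "tree_topology f =
     pullback_topology (trees f) (\<lambda>T. restrict (\<lambda>s. s \<in> T) (seq f))
       (product_topology (\<lambda>_. discrete_topology (UNIV :: bool set)) (seq f))"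

lemma topspace_tree_topology: "topspace (tree_topology f) = trees f"
  by (auto simp: tree_topology_def topspace_pullback_topology)

text \<open>Analytic sets are the empty set and the continuous images of the Baire space (the type
  \<open>nat \<Rightarrow> nat\<close> carries the product of the discrete topologies).\<close>

definition analytic_in :: "'a topology \<Rightarrow> 'a set \<Rightarrow> bool" where
  "analytic_in X A \<longleftrightarrow> A \<subseteq> topspace X \<and>
     (A = {} \<or> (\<exists>g. continuous_map (euclidean :: (nat \<Rightarrow> nat) topology) X g \<and> range g = A))"

definition bounded_branching_decay :: "nat list set set \<Rightarrow> bool" where
  "bounded_branching_decay A \<longleftrightarrow>
     (\<exists>T\<in>A. \<forall>S\<in>A. S \<subseteq> T \<longrightarrow> (\<forall>\<alpha>::real. 0 < \<alpha> \<and> \<alpha> < 1 \<longrightarrow>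
        liminf (\<lambda>n. ereal (real (height_fun S n) / real (height_fun T n) powr \<alpha>)) > 0))"


subsection \<open>Chain condition\<close>

text \<open>Posets are sets \<open>P\<close> of elements of an ordered type with the induced order; for families of
  sets this order is inclusion.\<close>

definition incompatible :: "'p::order set \<Rightarrow> 'p \<Rightarrow> 'p \<Rightarrow> bool" where
  "incompatible P p q \<longleftrightarrow> \<not> (\<exists>r\<in>P. r \<le> p \<and> r \<le> q)"

definition antichain_in :: "'p::order set \<Rightarrow> 'p set \<Rightarrow> bool" where
  "antichain_in P X \<longleftrightarrow> X \<subseteq> P \<and> pairwise (incompatible P) X"

definition ccc :: "'p::order set \<Rightarrow> bool" where
  "ccc P \<longleftrightarrow> (\<forall>X. antichain_in P X \<longrightarrow> countable X)"


subsection \<open>Forcing\<close>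

text \<open>A statement of the forcing language is represented by the predicate \<open>\<phi>\<close> such that
  \<open>\<phi> p\<close> means that \<open>p\<close> forces the statement. The connectives follow the usual recursive clauses of
  the forcing relation; the bound variables of \<open>f_all\<close> and \<open>f_ex\<close> range over ground model
  objects (natural numbers or ground model reals), and \<open>f_ground\<close> embeds statements that only
  mention such objects, which are absolute.\<close>

definition dense_below :: "'p::order set \<Rightarrow> 'p \<Rightarrow> 'p set \<Rightarrow> bool" where
  "dense_below P p D \<longleftrightarrow> (\<forall>q\<in>P. q \<le> p \<longrightarrow> (\<exists>r\<in>P. r \<le> q \<and> r \<in> D))"

definition f_ground :: "bool \<Rightarrow> 'p::order \<Rightarrow> bool" where
  "f_ground b p \<longleftrightarrow> b"

definition f_not :: "'p::order set \<Rightarrow> ('p \<Rightarrow> bool) \<Rightarrow> 'p \<Rightarrow> bool" where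
  "f_not P \<phi> p \<longleftrightarrow> (\<forall>q\<in>P. q \<le> p \<longrightarrow> \<not> \<phi> q)"

definition f_and :: "('p::order \<Rightarrow> bool) \<Rightarrow> ('p \<Rightarrow> bool) \<Rightarrow> 'p \<Rightarrow> bool" where
  "f_and \<phi> \<psi> p \<longleftrightarrow> \<phi> p \<and> \<psi> p"

definition f_imp :: "'p::order set \<Rightarrow> ('p \<Rightarrow> bool) \<Rightarrow> ('p \<Rightarrow> bool) \<Rightarrow> 'p \<Rightarrow> bool" where
  "f_imp P \<phi> \<psi> = f_not P (f_and \<phi> (f_not P \<psi>))"

definition f_all :: "('x \<Rightarrow> 'p::order \<Rightarrow> bool) \<Rightarrow> 'p \<Rightarrow> bool" where
  "f_all \<phi> p \<longleftrightarrow> (\<forall>x. \<phi> x p)"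

definition f_ex :: "'p::order set \<Rightarrow> ('x \<Rightarrow> 'p \<Rightarrow> bool) \<Rightarrow> 'p \<Rightarrow> bool" where
  "f_ex P \<phi> p \<longleftrightarrow> dense_below P p {q. \<exists>x. \<phi> x q}"

text \<open>A subset \<open>\<tau>\<close> of \<open>UNIV \<times> P\<close> is a name for the set of those \<open>x\<close> such that \<open>(x, r) \<in> \<tau>\<close> for
  some \<open>r\<close> in the generic filter. Every subset of the ground model set \<open>UNIV\<close> in the extension has
  such a name; a real in the extension is a function from naturals to naturals, viewed as a set of
  pairs.\<close>

definition f_mem :: "'p::order set \<Rightarrow> 'x \<Rightarrow> ('x \<times> 'p) set \<Rightarrow> 'p \<Rightarrow> bool" where
  "f_mem P x \<tau> p \<longleftrightarrow> dense_below P p {q. \<exists>r. (x, r) \<in> \<tau> \<and> q \<le> r}"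

definition f_real :: "'p::order set \<Rightarrow> ((nat \<times> nat) \<times> 'p) set \<Rightarrow> 'p \<Rightarrow> bool" where
  "f_real P \<tau> = f_and
     (f_all (\<lambda>n. f_ex P (\<lambda>k. f_mem P (n, k) \<tau>)))
     (f_all (\<lambda>n. f_all (\<lambda>k. f_all (\<lambda>k'.
        f_imp P (f_and (f_mem P (n, k) \<tau>) (f_mem P (n, k') \<tau>)) (f_ground (k = k'))))))"

definition f_eventually_dominated ::
    "'p::order set \<Rightarrow> ((nat \<times> nat) \<times> 'p) set \<Rightarrow> (nat \<Rightarrow> nat) \<Rightarrow> 'p \<Rightarrow> bool" where
  "f_eventually_dominated P \<tau> g =
     f_ex P (\<lambda>n0. f_all (\<lambda>n. f_imp P (f_ground (n0 \<le> n))
       (f_all (\<lambda>k. f_imp P (f_mem P (n, k) \<tau>) (f_ground (k \<le> g n))))))"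

definition weakly_distributive :: "'p::order set \<Rightarrow> bool" where
  "weakly_distributive P \<longleftrightarrow>
     (\<forall>\<tau> p. \<tau> \<subseteq> UNIV \<times> P \<and> p \<in> P \<and> f_real P \<tau> p \<longrightarrow>
        f_ex P (\<lambda>g :: nat \<Rightarrow> nat. f_eventually_dominated P \<tau> g) p)"


subsection \<open>Colourings\<close>

definition homogeneous :: "(nat list \<Rightarrow> nat) \<Rightarrow> nat list set \<Rightarrow> bool" where
  "homogeneous c A \<longleftrightarrow> c constant_on A"

end

theory Submission
  imports Defs "HOL-Library.Diagonal_Subsequence"
begin

text \<open>
  Suppose no colouring works. Then below every tree of the family and along every infinite set of levels,
  every colouring is constant on infinitely many levels of the core (the nodes extendible to all
  levels) of some smaller tree. Colour sparse levels of the tree \<open>T\<close> given by the decay hypothesis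
  uniformly at random. Since the family is a continuous image of the Baire space, it splits into
  countably many pieces, and after thinning out the levels every piece that matters handles a non-negligible
  proportion of the colourings of almost every level. By Kleitman's correlation inequality and
  Bogolyubov's argument in \<open>(\<int>/2)\<^sup>N\<close>, four dense families of subsets, each closed upwards, have
  members with an intersection of bounded size. A Cantor scheme therefore yields continuum many trees,
  any four of which have cores with a small intersection on infinitely many levels. But the countable chain
  condition gives four of them a common extension, and its core is too large: the decay hypothesis
  bounds its growth from below uniformly, again by a Cantor scheme and the chain condition.
\<close>

subsection \<open>Upwards closed families in the cube\<close>

text \<open>Two upwards closed families would not do: sets with at least |V|/2 + sqrt |V| elements
  have positive density in the cube, yet any two of them share at least 2 sqrt |V| points. With
  four, sums over the field with two elements capture a set missing only boundedly many points of V.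
  The bound depends on the density alone and not on |V|, so densities and bounds can be fixed by the
  index i of a level before the levels \<open>b i\<close> are chosen so sparse that the trees
  outgrow them.

  Dead ends are why cores replace levels: a colouring of level \<open>b i\<close>, read off at a
  deeper level, says nothing about nodes that die in between. But the decay hypothesis speaks of
  levels, and only from a point on that depends on the tree. For cores the growth is at first known
  infinitely often only, and uniformity over all trees has to be gained by bounding the gaps.

  The colourings handled by a set of trees form a union over possibly uncountably many trees; an
  ideal defined by explicit covers avoids questions of measurability.\<close>

definition up_family :: "'a set \<Rightarrow> 'a set set \<Rightarrow> bool" where
  "up_family V U \<longleftrightarrow> U \<subseteq> Pow V \<and> (\<forall>x\<in>U. \<forall>y. x \<subseteq> y \<and> y \<subseteq> V \<longrightarrow> y \<in> U)"

text \<open>Chebyshev's sum inequality for two terms. In \<open>kleitman\<close> the terms count the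
  members without and with a fixed point; upward closure orders them.\<close>

lemma kleitman_mult_ineq:
  fixes a0 a1 b0 b1 :: real
  assumes "a0 \<le> a1" "b0 \<le> b1"
  shows "(a0 + a1) * (b0 + b1) \<le> 2 * (a0 * b0 + a1 * b1)"
proof -
  have "0 \<le> (a1 - a0) * (b1 - b0)" using assms by simp
  then show ?thesis by (simp add: algebra_simps)
qed

lemma up_family_inter: "up_family V U \<Longrightarrow> up_family V W \<Longrightarrow> up_family V (U \<inter> W)"
  unfolding up_family_def by (auto simp del: Pow_iff)

text \<open>Upwards closed families are positively correlated under the uniform measure. Sectioning
  at \<open>v\<close> gives families on \<open>V\<close> with \<open>U0 X \<subseteq> U1 X\<close>;
  the induction hypothesis applies to each section, and Chebyshev's inequality recombines
  them.\<close>

lemma kleitman: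
  assumes "finite V" "up_family V U" "up_family V W"
  shows "real (card U) * real (card W) \<le> 2 ^ card V * real (card (U \<inter> W))"
  using assms
proof (induction V arbitrary: U W rule: finite_induct)
  case empty
  then have "U \<subseteq> {{}}" "W \<subseteq> {{}}" by (auto simp: up_family_def)
  then have "U = {} \<or> U = {{}}" "W = {} \<or> W = {{}}" by auto
  then show ?case by auto
next
  case (insert v V)
  define U0 where "U0 X = X \<inter> Pow V" for X :: "'a set set"
  define U1 where "U1 X = {x \<in> Pow V. insert v x \<in> X}" for X :: "'a set set"
  have split: "card X = card (U0 X) + card (U1 X)" if "X \<subseteq> Pow (insert v V)" for X
  proof -
    have X: "X = U0 X \<union> insert v ` U1 X"
    proof
      show "X \<subseteq> U0 X \<union> insert v ` U1 X"
      proof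
        fix x assume x: "x \<in> X"
        show "x \<in> U0 X \<union> insert v ` U1 X"
        proof (cases "v \<in> x")
          case True
          then have "x = insert v (x - {v})" by auto
          moreover from this have "x - {v} \<in> U1 X" using x that by (auto simp: U1_def)
          ultimately show ?thesis by blast
        next
          case False
          then show ?thesis using x that by (auto simp: U0_def)
        qed
      qed
    qed (auto simp: U0_def U1_def)
    have fin: "finite (U0 X)" "finite (U1 X)" using insert.hyps by (auto simp: U0_def U1_def)
    have "inj_on (insert v) (Pow V)"
    proof (rule inj_onI)
      fix x y assume "x \<in> Pow V" "y \<in> Pow V" and eq: "insert v x = insert v y"
      then have "v \<notin> x" "v \<notin> y" using insert.hyps by auto
      then show "x = y" using eq by (simp add: insert_ident)
    qed
    then have "inj_on (insert v) (U1 X)" by (rule inj_on_subset) (auto simp: U1_def)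
    moreover have "U0 X \<inter> insert v ` U1 X = {}" using insert.hyps by (auto simp: U0_def)
    ultimately have "card (U0 X \<union> insert v ` U1 X) = card (U0 X) + card (U1 X)"
      using fin by (simp add: card_Un_disjoint card_image)
    then show ?thesis using X by simp
  qed
  have up: "up_family V (U0 X)" "up_family V (U1 X)" "U0 X \<subseteq> U1 X" if X: "up_family (insert v V) X" for X
  proof -
    have *: "y \<in> X" if "x \<in> X" "x \<subseteq> y" "y \<subseteq> insert v V" for x y
      using X that unfolding up_family_def by blast
    show "up_family V (U0 X)" unfolding up_family_def U0_def using * by blast
    show "up_family V (U1 X)" unfolding up_family_def U1_def
    proof (intro conjI ballI allI impI)
      fix x y assume "x \<in> {x \<in> Pow V. insert v x \<in> X}" "x \<subseteq> y \<and> y \<subseteq> V"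
      then show "y \<in> {x \<in> Pow V. insert v x \<in> X}" using *[of "insert v x" "insert v y"] by auto
    qed auto
    show "U0 X \<subseteq> U1 X" unfolding U0_def U1_def
    proof
      fix x assume "x \<in> X \<inter> Pow V"
      then show "x \<in> {x \<in> Pow V. insert v x \<in> X}" using *[of x "insert v x"] by auto
    qed
  qed
  have le: "real (card (U0 X)) \<le> real (card (U1 X))" if "up_family (insert v V) X" for X
    using up[OF that] insert.hyps by (simp add: U1_def card_mono)
  have U: "card U = card (U0 U) + card (U1 U)" and W: "card W = card (U0 W) + card (U1 W)"
    and UW: "card (U \<inter> W) = card (U0 (U \<inter> W)) + card (U1 (U \<inter> W))"
    using insert.prems by (auto intro!: split simp: up_family_def)
  have eq: "U0 (U \<inter> W) = U0 U \<inter> U0 W" "U1 (U \<inter> W) = U1 U \<inter> U1 W" by (auto simp: U0_def U1_def)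
  have "real (card U) * real (card W) \<le>
      2 * (real (card (U0 U)) * real (card (U0 W)) + real (card (U1 U)) * real (card (U1 W)))"
    using kleitman_mult_ineq[OF le le, OF insert.prems] U W by simp
  also have "\<dots> \<le> 2 * (2 ^ card V * real (card (U0 U \<inter> U0 W)) + 2 ^ card V * real (card (U1 U \<inter> U1 W)))"
    using insert.IH[OF up(1) up(1)] insert.IH[OF up(2) up(2)] insert.prems
    by (intro mult_left_mono add_mono) auto
  also have "\<dots> = 2 ^ card (insert v V) * real (card (U \<inter> W))"
    using insert.hyps UW eq by (simp add: algebra_simps)
  finally show ?case .
qed

text \<open>The Walsh character with index \<open>\<xi>\<close> of the group of subsets under
  symmetric difference.\<close>

definition chr :: "'a set \<Rightarrow> 'a set \<Rightarrow> real" where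
  "chr \<xi> e = (-1) ^ card (e \<inter> \<xi>)"

lemma chr_sym_diff:
  assumes "finite a" "finite b"
  shows "chr \<xi> (sym_diff a b) = chr \<xi> a * chr \<xi> b"
proof -
  let ?A = "a \<inter> \<xi>" and ?B = "b \<inter> \<xi>"
  have f: "finite ?A" "finite ?B" using assms by auto
  have c: "card ?A = card (?A - ?B) + card (?A \<inter> ?B)" "card ?B = card (?B - ?A) + card (?A \<inter> ?B)"
    using card_Diff_subset_Int[of ?A ?B] card_Diff_subset_Int[of ?B ?A] f
      card_mono[OF f(1) Int_lower1, of ?B] card_mono[OF f(2) Int_lower2, of ?A]
    by (simp_all add: Int_commute)
  have "sym_diff a b \<inter> \<xi> = (?A - ?B) \<union> (?B - ?A)" by auto
  then have "card (sym_diff a b \<inter> \<xi>) = card (?A - ?B) + card (?B - ?A)"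
    using f by (simp only:) (intro card_Un_disjoint; blast)
  moreover have "(-1 :: real) ^ k * (-1) ^ k = 1" for k :: nat by (simp flip: power_mult_distrib)
  ultimately show ?thesis unfolding chr_def c
    by (simp add: power_add mult_ac)
qed

lemma abs_chr: "\<bar>chr \<xi> e\<bar> = 1"
  by (simp add: chr_def)

lemma chr_commute: "chr \<xi> e = chr e \<xi>"
  by (simp add: chr_def Int_commute)

text \<open>Toggling a fixed point of \<open>z\<close> in \<open>\<xi>\<close> is an involution of
  \<open>Pow V\<close> that flips the sign of every term.\<close>

lemma sum_chr_nonempty:
  assumes "finite V" "z \<subseteq> V" "z \<noteq> {}"
  shows "(\<Sum>\<xi>\<in>Pow V. chr \<xi> z) = 0"
proof -
  obtain a where a: "a \<in> z" using assms by auto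
  have fl: "chr (sym_diff \<xi> {a}) z = - chr \<xi> z" if "\<xi> \<in> Pow V" for \<xi>
  proof -
    have "finite \<xi>" using that assms(1) by (auto intro: finite_subset)
    then have "chr (sym_diff \<xi> {a}) z = chr z \<xi> * chr z {a}"
      by (subst chr_commute) (simp only: chr_sym_diff finite.intros)
    also have "chr z {a} = -1" using a by (simp add: chr_def)
    finally show ?thesis by (simp add: chr_commute)
  qed
  have inv: "sym_diff (sym_diff \<xi> {a}) {a} = \<xi>" for \<xi> :: "'a set" by auto
  have "(\<Sum>\<xi>\<in>Pow V. chr \<xi> z) = (\<Sum>\<xi>\<in>Pow V. chr (sym_diff \<xi> {a}) z)"
    by (rule sum.reindex_bij_witness[where i = "\<lambda>\<xi>. sym_diff \<xi> {a}" and j = "\<lambda>\<xi>. sym_diff \<xi> {a}"])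
      (use a assms(2) in \<open>simp_all only: inv, auto\<close>)
  also have "\<dots> = - (\<Sum>\<xi>\<in>Pow V. chr \<xi> z)" using fl by (simp add: sum_negf)
  finally show ?thesis by simp
qed

lemma sum_chr_empty: "finite V \<Longrightarrow> (\<Sum>\<xi>\<in>Pow V. chr \<xi> {}) = 2 ^ card V"
  by (simp add: chr_def card_Pow)

text \<open>Expanding the square gives characters of \<open>sym_diff e e'\<close>; orthogonality
  leaves only the diagonal.\<close>

lemma parseval:
  assumes "finite V" "E \<subseteq> Pow V"
  shows "(\<Sum>\<xi>\<in>Pow V. (\<Sum>e\<in>E. chr \<xi> e)\<^sup>2) = 2 ^ card V * real (card E)"
proof -
  have fE: "finite E" using assms by (auto intro: finite_subset)
  have fin: "finite e" if "e \<in> E" for e using that assms by (auto intro: finite_subset)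
  have "(\<Sum>\<xi>\<in>Pow V. (\<Sum>e\<in>E. chr \<xi> e)\<^sup>2) = (\<Sum>\<xi>\<in>Pow V. \<Sum>e\<in>E. \<Sum>e'\<in>E. chr \<xi> (sym_diff e e'))"
    by (intro sum.cong refl) (simp add: power2_eq_square sum_product chr_sym_diff fin)
  also have "\<dots> = (\<Sum>e\<in>E. \<Sum>e'\<in>E. \<Sum>\<xi>\<in>Pow V. chr \<xi> (sym_diff e e'))"
    by (simp only: sum.swap[where A = "Pow V"])
  also have "\<dots> = (\<Sum>e\<in>E. \<Sum>e'\<in>E. if e' = e then 2 ^ card V else 0)"
  proof (intro sum.cong refl)
    fix e e' assume "e \<in> E" "e' \<in> E"
    then show "(\<Sum>\<xi>\<in>Pow V. chr \<xi> (sym_diff e e')) = (if e' = e then 2 ^ card V else 0)"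
      using assms by (cases "e' = e") (simp_all add: sum_chr_empty, rule sum_chr_nonempty, auto)
  qed
  also have "\<dots> = 2 ^ card V * real (card E)" using fE by simp
  finally show ?thesis .
qed

text \<open>Up to the factor \<open>2 ^ card V\<close>, the sum counts the representations of
  \<open>x\<close> as a symmetric difference of four members of \<open>E\<close>: each quadruple
  contributes the character sum of \<open>q p\<close>, which vanishes unless \<open>q p\<close> is
  empty.\<close>

lemma sum_four_chr:
  assumes "finite V" "E \<subseteq> Pow V" "x \<subseteq> V"
    and no: "\<And>a b c d. a \<in> E \<Longrightarrow> b \<in> E \<Longrightarrow> c \<in> E \<Longrightarrow> d \<in> E \<Longrightarrow>
               x \<noteq> sym_diff (sym_diff a b) (sym_diff c d)"
  shows "(\<Sum>\<xi>\<in>Pow V. (\<Sum>e\<in>E. chr \<xi> e) ^ 4 * chr \<xi> x) = 0"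
proof -
  have fin: "finite e" if "e \<in> E" for e using that assms by (auto intro: finite_subset)
  have fx: "finite x" using finite_subset[OF assms(3,1)] .
  have prod_sums: "sum u X * sum v Y = (\<Sum>p\<in>X\<times>Y. u (fst p) * v (snd p))"
    for u :: "'b \<Rightarrow> real" and v :: "'c \<Rightarrow> real" and X Y
    by (simp add: sum_product sum.cartesian_product case_prod_unfold)
  define q where "q = (\<lambda>(a, b, c, d). sym_diff (sym_diff (sym_diff a b) (sym_diff c d)) x)"
  have "(\<Sum>\<xi>\<in>Pow V. (\<Sum>e\<in>E. chr \<xi> e) ^ 4 * chr \<xi> x) = (\<Sum>\<xi>\<in>Pow V. \<Sum>p\<in>E\<times>E\<times>E\<times>E. chr \<xi> (q p))"
  proof (intro sum.cong refl)
    fix \<xi> assume "\<xi> \<in> Pow V"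
    let ?F = "\<Sum>e\<in>E. chr \<xi> e"
    have "?F ^ 4 * chr \<xi> x = (?F * (?F * (?F * ?F))) * chr \<xi> x" by (simp add: numeral_eq_Suc)
    also have "\<dots> = (\<Sum>(a,b,c,d)\<in>E\<times>E\<times>E\<times>E. chr \<xi> a * (chr \<xi> b * (chr \<xi> c * chr \<xi> d)) * chr \<xi> x)"
      by (simp only: prod_sums case_prod_unfold) (simp only: sum_distrib_right)
    also have "\<dots> = (\<Sum>p\<in>E\<times>E\<times>E\<times>E. chr \<xi> (q p))"
    proof (intro sum.cong refl)
      fix p assume "p \<in> E\<times>E\<times>E\<times>E"
      then obtain a b c d where p: "p = (a, b, c, d)" "a \<in> E" "b \<in> E" "c \<in> E" "d \<in> E" by auto
      have f: "finite a" "finite b" "finite c" "finite d" using p fin by auto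
      have f2: "finite (sym_diff a b)" "finite (sym_diff c d)" using f by auto
      have f3: "finite (sym_diff (sym_diff a b) (sym_diff c d))" using f2 by auto
      have "chr \<xi> (q p) = chr \<xi> (sym_diff (sym_diff a b) (sym_diff c d)) * chr \<xi> x"
        unfolding q_def p(1) prod.case by (rule chr_sym_diff[OF f3 fx])
      also have "\<dots> = (chr \<xi> a * chr \<xi> b) * (chr \<xi> c * chr \<xi> d) * chr \<xi> x"
        by (simp only: chr_sym_diff[OF f2] chr_sym_diff[OF f(1,2)] chr_sym_diff[OF f(3,4)])
      finally show "(case p of (a,b,c,d) \<Rightarrow> chr \<xi> a * (chr \<xi> b * (chr \<xi> c * chr \<xi> d)) * chr \<xi> x) = chr \<xi> (q p)"
        by (simp add: p(1) mult_ac)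
    qed
    finally show "?F ^ 4 * chr \<xi> x = (\<Sum>p\<in>E\<times>E\<times>E\<times>E. chr \<xi> (q p))" .
  qed
  also have "\<dots> = (\<Sum>p\<in>E\<times>E\<times>E\<times>E. \<Sum>\<xi>\<in>Pow V. chr \<xi> (q p))"
    by (rule sum.swap)
  also have "\<dots> = 0"
  proof (rule sum.neutral, rule ballI)
    fix p assume "p \<in> E\<times>E\<times>E\<times>E"
    then obtain a b c d where p: "p = (a, b, c, d)" "a \<in> E" "b \<in> E" "c \<in> E" "d \<in> E" by auto
    have "q p \<noteq> {}" using no[OF p(2-5)] unfolding q_def p(1) prod.case by auto
    moreover have "q p \<subseteq> V" using p assms(2,3) unfolding q_def p(1) prod.case by auto
    ultimately show "(\<Sum>\<xi>\<in>Pow V. chr \<xi> (q p)) = 0" using assms(1) by (intro sum_chr_nonempty)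
  qed
  finally show ?thesis .
qed

text \<open>A largest set annihilated by \<open>\<Xi>\<close> works: if it missed more than
  \<open>card \<Xi>\<close> points, two subsets of the missing set would have the same sign pattern
  on \<open>\<Xi>\<close>, and their symmetric difference could be added.\<close>

lemma exists_large_set_orthogonal:
  assumes "finite V" "finite \<Xi>"
  obtains x where "x \<subseteq> V" "\<And>\<xi>. \<xi> \<in> \<Xi> \<Longrightarrow> chr \<xi> x = 1" "card (V - x) \<le> card \<Xi>"
proof -
  define Orth where "Orth = {x. x \<subseteq> V \<and> (\<forall>\<xi>\<in>\<Xi>. chr \<xi> x = 1)}"
  have finOrth: "finite Orth" using assms(1) by (auto simp: Orth_def)
  have "{} \<in> Orth" by (auto simp: Orth_def chr_def)
  then have "Max (card ` Orth) \<in> card ` Orth" using finOrth by (intro Max_in) auto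
  then obtain x where x: "x \<in> Orth" "card x = Max (card ` Orth)" by (metis imageE)
  have max: "card y \<le> card x" if "y \<in> Orth" for y using that finOrth x(2) by simp
  have "card (V - x) \<le> card \<Xi>"
  proof (rule ccontr)
    assume "\<not> ?thesis"
    then have lt: "card \<Xi> < card (V - x)" by simp
    define \<rho> where "\<rho> a = {\<xi>\<in>\<Xi>. chr \<xi> a = 1}" for a :: "'a set"
    have "\<rho> ` Pow (V - x) \<subseteq> Pow \<Xi>" by (auto simp: \<rho>_def)
    then have "card (\<rho> ` Pow (V - x)) \<le> 2 ^ card \<Xi>"
      using assms(2) by (metis card_Pow card_mono finite_Pow_iff)
    also have "\<dots> < card (Pow (V - x))" using lt assms(1) by (simp add: card_Pow)
    finally have "\<not> inj_on \<rho> (Pow (V - x))" using card_image by fastforce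
    then obtain a b where ab: "a \<subseteq> V - x" "b \<subseteq> V - x" "a \<noteq> b" "\<rho> a = \<rho> b"
      by (auto simp: inj_on_def)
    have fin: "finite a" "finite b" "finite x" using ab x(1) assms(1) by (auto simp: Orth_def intro: finite_subset)
    define e where "e = sym_diff a b"
    have e: "e \<subseteq> V - x" "e \<noteq> {}" "finite e" using ab fin by (auto simp: e_def)
    have che: "chr \<xi> e = 1" if "\<xi> \<in> \<Xi>" for \<xi>
    proof -
      have "chr \<xi> a = 1 \<longleftrightarrow> chr \<xi> b = 1" using ab(4) that by (auto simp: \<rho>_def)
      moreover have "chr \<xi> a = 1 \<or> chr \<xi> a = -1" "chr \<xi> b = 1 \<or> chr \<xi> b = -1"
        using abs_chr[of \<xi> a] abs_chr[of \<xi> b] by (auto simp: abs_if split: if_splits)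
      ultimately show ?thesis unfolding e_def chr_sym_diff[OF fin(1,2)] by auto
    qed
    have xe: "x \<union> e = sym_diff x e" using e by auto
    have "chr \<xi> (x \<union> e) = 1" if "\<xi> \<in> \<Xi>" for \<xi>
      using x(1) che[OF that] that chr_sym_diff[OF fin(3) e(3), of \<xi>] unfolding xe[symmetric] by (simp add: Orth_def)
    then have "x \<union> e \<in> Orth" using x(1) e by (auto simp: Orth_def)
    then have "card (x \<union> e) \<le> card x" by (rule max)
    moreover have "card (x \<union> e) = card x + card e" using e fin by (intro card_Un_disjoint) auto
    ultimately show False using e by simp
  qed
  with x(1) that show ?thesis by (auto simp: Orth_def)
qed

text \<open>The Fourier coefficients \<open>F\<close> split into a large spectrum
  \<open>\<Xi>\<close>, of bounded size by Parseval, and a negligible rest. For \<open>x\<close>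
  annihilated by \<open>\<Xi>\<close> the large terms are nonnegative, so the sum in
  \<open>sum_four_chr\<close> is positive and \<open>x\<close> is a symmetric difference of four
  members of \<open>E\<close>, whose union must contain \<open>x\<close>.\<close>

lemma bogolyubov:
  fixes \<eta> :: real
  assumes V: "finite V" and E: "E \<subseteq> Pow V" and \<eta>: "0 < \<eta>" and dense: "\<eta> * 2 ^ card V \<le> real (card E)"
  obtains a b c d where "a \<in> E" "b \<in> E" "c \<in> E" "d \<in> E"
    "real (card (V - (a \<union> b \<union> c \<union> d))) \<le> 2 / \<eta>\<^sup>2"
proof -
  define F where "F \<xi> = (\<Sum>e\<in>E. chr \<xi> e)" for \<xi>
  define N :: real where "N = 2 ^ card V"
  define m where "m = real (card E)"
  have N: "N > 0" by (simp add: N_def)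
  have m: "m \<ge> \<eta> * N" using dense by (simp add: m_def N_def)
  then have m0: "m > 0" using mult_pos_pos[OF \<eta> N] by linarith
  \<comment> \<open>Chosen so that the coefficients below the threshold contribute at most
    \<open>\<theta> * (N * m) = m ^ 4 / 2\<close>, half of the term \<open>m ^ 4\<close> of the
    trivial character.\<close>
  define \<theta> where "\<theta> = m ^ 3 / (2 * N)"
  have \<theta>: "\<theta> > 0" using m m0 N by (simp add: \<theta>_def)
  define \<Xi> where "\<Xi> = {\<xi>\<in>Pow V. (F \<xi>)\<^sup>2 \<ge> \<theta>}"
  have fin\<Xi>: "finite \<Xi>" using V by (simp add: \<Xi>_def)
  have pars: "(\<Sum>\<xi>\<in>Pow V. (F \<xi>)\<^sup>2) = N * m"
    using parseval[OF V E] by (simp add: F_def N_def m_def)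
  have F0: "F {} = m" by (simp add: F_def m_def chr_def)
  have "m \<le> N" using card_mono[OF _ E] V by (simp add: m_def N_def card_Pow flip: of_nat_le_iff)
  then have "m * m\<^sup>2 \<le> (2 * N) * m\<^sup>2" using N by (intro mult_right_mono) auto
  then have "\<theta> \<le> m\<^sup>2" using N by (simp add: \<theta>_def field_simps power2_eq_square power3_eq_cube)
  then have "{} \<in> \<Xi>" by (simp add: \<Xi>_def F0)
  have "\<theta> * real (card \<Xi>) = (\<Sum>\<xi>\<in>\<Xi>. \<theta>)" by simp
  also have "\<dots> \<le> (\<Sum>\<xi>\<in>\<Xi>. (F \<xi>)\<^sup>2)" by (intro sum_mono) (simp add: \<Xi>_def)
  also have "\<dots> \<le> (\<Sum>\<xi>\<in>Pow V. (F \<xi>)\<^sup>2)" using V by (intro sum_mono2) (auto simp: \<Xi>_def)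
  finally have "\<theta> * real (card \<Xi>) \<le> N * m" using pars by simp
  then have "real (card \<Xi>) \<le> N * m / \<theta>" using \<theta> by (simp add: field_simps)
  also have "\<dots> = 2 * (N / m)\<^sup>2" using m m0 N by (simp add: \<theta>_def field_simps power2_eq_square power3_eq_cube)
  also have "\<dots> \<le> 2 * (1 / \<eta>)\<^sup>2" using m m0 N \<eta> by (intro mult_left_mono power_mono) (auto simp: field_simps)
  finally have card\<Xi>: "real (card \<Xi>) \<le> 2 / \<eta>\<^sup>2" by (simp add: power_divide)
  obtain x where x: "x \<subseteq> V" "\<And>\<xi>. \<xi> \<in> \<Xi> \<Longrightarrow> chr \<xi> x = 1" "card (V - x) \<le> card \<Xi>"
    using exists_large_set_orthogonal[OF V fin\<Xi>] by metis
  have "(\<Sum>\<xi>\<in>Pow V. F \<xi> ^ 4 * chr \<xi> x) > 0"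
  proof -
    have F4: "F \<xi> ^ 4 = (F \<xi>)\<^sup>2 * (F \<xi>)\<^sup>2" for \<xi> by (simp flip: power_add)
    have "(\<Sum>\<xi>\<in>Pow V. F \<xi> ^ 4 * chr \<xi> x)
        = (\<Sum>\<xi>\<in>\<Xi>. F \<xi> ^ 4 * chr \<xi> x) + (\<Sum>\<xi>\<in>Pow V - \<Xi>. F \<xi> ^ 4 * chr \<xi> x)"
      using V by (intro sum.subset_diff[THEN trans[OF _ add.commute]]) (auto simp: \<Xi>_def)
    moreover have "(\<Sum>\<xi>\<in>\<Xi>. F \<xi> ^ 4 * chr \<xi> x) \<ge> m ^ 4"
    proof -
      have "m ^ 4 = (\<Sum>\<xi>\<in>{{}}. F \<xi> ^ 4)" by (simp add: F0)
      also have "\<dots> \<le> (\<Sum>\<xi>\<in>\<Xi>. F \<xi> ^ 4)"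
        using fin\<Xi> \<open>{} \<in> \<Xi>\<close> by (intro sum_mono2) auto
      also have "\<dots> = (\<Sum>\<xi>\<in>\<Xi>. F \<xi> ^ 4 * chr \<xi> x)" using x(2) by simp
      finally show ?thesis .
    qed
    moreover have "(\<Sum>\<xi>\<in>Pow V - \<Xi>. F \<xi> ^ 4 * chr \<xi> x) \<ge> - (\<theta> * (N * m))"
    proof -
      have "- (\<theta> * (N * m)) = (\<Sum>\<xi>\<in>Pow V. - \<theta> * (F \<xi>)\<^sup>2)"
        by (simp only: pars flip: sum_distrib_left)
      also have "\<dots> \<le> (\<Sum>\<xi>\<in>Pow V - \<Xi>. - \<theta> * (F \<xi>)\<^sup>2)"
      proof -
        have "(\<Sum>\<xi>\<in>Pow V - \<Xi>. \<theta> * (F \<xi>)\<^sup>2) \<le> (\<Sum>\<xi>\<in>Pow V. \<theta> * (F \<xi>)\<^sup>2)"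
          using V \<theta> by (intro sum_mono2) auto
        then show ?thesis by (simp add: sum_negf)
      qed
      also have "\<dots> \<le> (\<Sum>\<xi>\<in>Pow V - \<Xi>. F \<xi> ^ 4 * chr \<xi> x)"
      proof (intro sum_mono)
        fix \<xi> assume "\<xi> \<in> Pow V - \<Xi>"
        then have "(F \<xi>)\<^sup>2 \<le> \<theta>" by (auto simp: \<Xi>_def)
        then have "F \<xi> ^ 4 \<le> \<theta> * (F \<xi>)\<^sup>2" unfolding F4 by (intro mult_right_mono) auto
        moreover have "chr \<xi> x = 1 \<or> chr \<xi> x = -1" using abs_chr[of \<xi> x] by (auto simp: abs_if split: if_splits)
        moreover have "0 \<le> F \<xi> ^ 4" by simp
        ultimately show "- \<theta> * (F \<xi>)\<^sup>2 \<le> F \<xi> ^ 4 * chr \<xi> x" using \<theta> by (auto intro: order_trans[of _ 0])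
      qed
      finally show ?thesis .
    qed
    moreover have "\<theta> * (N * m) = m ^ 4 / 2" using N by (simp add: \<theta>_def power_numeral_reduce)
    moreover have "m ^ 4 > 0" using m0 by simp
    ultimately show ?thesis by linarith
  qed
  then obtain a b c d where abcd: "a \<in> E" "b \<in> E" "c \<in> E" "d \<in> E"
      "x = sym_diff (sym_diff a b) (sym_diff c d)"
    using sum_four_chr[OF V E x(1)] unfolding F_def by (metis (no_types, lifting) less_irrefl)
  have "card (V - (a \<union> b \<union> c \<union> d)) \<le> card (V - x)"
    using V abcd(5) by (intro card_mono) auto
  then have "real (card (V - (a \<union> b \<union> c \<union> d))) \<le> 2 / \<eta>\<^sup>2" using x(3) card\<Xi> by linarith
  with abcd that show ?thesis by blast
qed

text \<open>Two rounds of Kleitman's inequality show that the common part \<open>W\<close> of the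
  four families has density at least \<open>\<delta> ^ 4\<close>. Sets found in \<open>W\<close>
  belong to all four families, so they can be assigned to the indices arbitrarily.\<close>

lemma four_up_families:
  fixes \<delta> :: real and U :: "'i \<Rightarrow> 'a set set"
  assumes V: "finite V" and up: "\<And>i. i \<in> K \<Longrightarrow> up_family V (U i)" and K: "card K = 4"
    and \<delta>: "0 < \<delta>" and dense: "\<And>i. i \<in> K \<Longrightarrow> \<delta> * 2 ^ card V \<le> real (card (U i))"
  obtains y where "\<And>i. i \<in> K \<Longrightarrow> y i \<in> U i" "real (card (\<Inter>i\<in>K. y i)) \<le> 2 / (\<delta> ^ 4)\<^sup>2"
proof -
  have "finite K" using K by (metis card.infinite zero_neq_numeral)
  then obtain ks where ks: "set ks = K" "distinct ks" using finite_distinct_list by blast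
  then have "length ks = 4" using K distinct_card by fastforce
  then obtain p q r t where "ks = [p, q, r, t]" by (auto simp: numeral_eq_Suc length_Suc_conv)
  then have Kd: "K = {p, q, r, t}" and dist: "distinct [p, q, r, t]" using ks by auto
  define N :: real where "N = 2 ^ card V"
  have N: "N > 0" by (simp add: N_def)
  have two: "real (card (X \<inter> Y)) \<ge> \<alpha> * \<beta> * N \<and> up_family V (X \<inter> Y)"
    if "up_family V X" "up_family V Y" "\<alpha> * N \<le> real (card X)" "\<beta> * N \<le> real (card Y)" "0 < \<alpha>" "0 < \<beta>"
    for X Y \<alpha> \<beta>
  proof -
    have "(\<alpha> * N) * (\<beta> * N) \<le> real (card X) * real (card Y)" using that N by (intro mult_mono) auto
    also have "\<dots> \<le> N * real (card (X \<inter> Y))" using kleitman[OF V that(1,2)] by (simp add: N_def)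
    finally have "N * (\<alpha> * \<beta> * N) \<le> N * real (card (X \<inter> Y))" by (simp add: mult_ac)
    then show ?thesis using N up_family_inter[OF that(1,2)] by simp
  qed
  have d: "\<delta> * N \<le> real (card (U i))" if "i \<in> K" for i using dense[OF that] by (simp add: N_def)
  define W where "W = (U p \<inter> U q) \<inter> (U r \<inter> U t)"
  have "real (card W) \<ge> (\<delta> * \<delta>) * (\<delta> * \<delta>) * N \<and> up_family V W"
    unfolding W_def using two[OF up up d d \<delta> \<delta>, of p q] two[OF up up d d \<delta> \<delta>, of r t] Kd \<delta>
    by (intro two) auto
  then have W: "\<delta> ^ 4 * N \<le> real (card W)" "up_family V W" by (auto simp: power_numeral_reduce mult_ac)
  \<comment> \<open>Complementation turns the almost covering union supplied by
    \<open>bogolyubov\<close> into a small intersection.\<close>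
  define E where "E = (\<lambda>y. V - y) ` W"
  have "inj_on (\<lambda>y. V - y) W" using W(2) by (intro inj_onI) (metis PowD double_diff order_refl subsetD up_family_def)
  then have "card E = card W" by (simp add: E_def card_image)
  have EV: "E \<subseteq> Pow V" by (auto simp: E_def)
  have "\<delta> ^ 4 * 2 ^ card V \<le> real (card E)" using W(1) \<open>card E = card W\<close> by (simp add: N_def)
  then obtain a b c d where abcd: "a \<in> E" "b \<in> E" "c \<in> E" "d \<in> E"
    "real (card (V - (a \<union> b \<union> c \<union> d))) \<le> 2 / (\<delta> ^ 4)\<^sup>2"
    using bogolyubov[OF V _ zero_less_power[OF \<delta>], of E] EV by metis
  then obtain a' b' c' d' where w: "a' \<in> W" "b' \<in> W" "c' \<in> W" "d' \<in> W"
    "a = V - a'" "b = V - b'" "c = V - c'" "d = V - d'" by (auto simp: E_def)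
  define y where "y = (\<lambda>i. if i = p then a' else if i = q then b' else if i = r then c' else d')"
  have y: "y p = a'" "y q = b'" "y r = c'" "y t = d'" using dist by (auto simp: y_def)
  have "(\<Inter>i\<in>K. y i) = V - (a \<union> b \<union> c \<union> d)"
    using w W(2) by (auto simp: Kd y up_family_def)
  moreover have "y i \<in> U i" if "i \<in> K" for i using that w y Kd by (auto simp: W_def)
  ultimately show ?thesis using abcd(5) by (intro that[of y]) simp_all
qed

subsection \<open>Limsup-null sets of choice sequences\<close>

text \<open>A substitute for null sets of a product of uniform measures: the sets to which the Borel--Cantelli
  lemma applies.\<close>

definition limsup_null :: "(nat \<Rightarrow> 'a set) \<Rightarrow> (nat \<Rightarrow> 'a) set \<Rightarrow> bool" where
  "limsup_null \<Omega> X \<longleftrightarrow> (\<exists>Y. (\<forall>i. Y i \<subseteq> \<Omega> i) \<and>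
     summable (\<lambda>i. real (card (Y i)) / real (card (\<Omega> i))) \<and> (\<forall>c\<in>X. \<exists>\<^sub>\<infinity>i. c i \<in> Y i))"

lemma limsup_null_subset: "limsup_null \<Omega> X \<Longrightarrow> X' \<subseteq> X \<Longrightarrow> limsup_null \<Omega> X'"
  unfolding limsup_null_def by blast

text \<open>The ideal is proper: from some index on the proportions are below 1, so a sequence can
  avoid every later \<open>Y i\<close>.\<close>

lemma not_limsup_null_all:
  assumes "\<And>i. finite (\<Omega> i)" "\<And>i. \<Omega> i \<noteq> {}"
  shows "\<not> limsup_null \<Omega> {c. \<forall>i. c i \<in> \<Omega> i}"
proof
  assume "limsup_null \<Omega> {c. \<forall>i. c i \<in> \<Omega> i}"
  then obtain Y where Y: "\<And>i. Y i \<subseteq> \<Omega> i" "summable (\<lambda>i. real (card (Y i)) / real (card (\<Omega> i)))"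
    "\<And>c. \<forall>i. c i \<in> \<Omega> i \<Longrightarrow> \<exists>\<^sub>\<infinity>i. c i \<in> Y i" unfolding limsup_null_def by blast
  have "(\<lambda>i. real (card (Y i)) / real (card (\<Omega> i))) \<longlonglongrightarrow> 0" using Y(2) by (rule summable_LIMSEQ_zero)
  then have "\<forall>\<^sub>F i in sequentially. real (card (Y i)) / real (card (\<Omega> i)) < 1"
    by (rule order_tendstoD) simp
  then obtain n where n: "\<And>i. i \<ge> n \<Longrightarrow> real (card (Y i)) / real (card (\<Omega> i)) < 1"
    by (auto simp: eventually_sequentially)
  have "\<exists>y. y \<in> \<Omega> i \<and> (i \<ge> n \<longrightarrow> y \<notin> Y i)" for i
  proof (cases "i \<ge> n")
    case True
    have "card (\<Omega> i) > 0" using assms by (simp add: card_gt_0_iff)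
    then have "Y i \<noteq> \<Omega> i" using n[OF True] by auto
    then show ?thesis using Y(1)[of i] by auto
  next
    case False
    then show ?thesis using assms(2)[of i] by auto
  qed
  then obtain c where c: "\<And>i. c i \<in> \<Omega> i" "\<And>i. i \<ge> n \<Longrightarrow> c i \<notin> Y i" by metis
  have "\<exists>\<^sub>\<infinity>i. c i \<in> Y i" using c(1) by (intro Y(3)) simp
  then show False using c(2) unfolding INFM_nat_le by blast
qed

text \<open>Membership infinitely often ignores an initial segment of a cover. The cover of
  \<open>X k\<close> is started at \<open>m k\<close>, where its remaining sum is at most
  \<open>(1/2) ^ k\<close>, so the combined sums stay at most 2.\<close>

lemma limsup_null_UN:
  fixes X :: "nat \<Rightarrow> (nat \<Rightarrow> 'a) set"
  assumes fin: "\<And>i. finite (\<Omega> i)" and X: "\<And>k. limsup_null \<Omega> (X k)"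
  shows "limsup_null \<Omega> (\<Union>k. X k)"
proof -
  obtain Y where Y: "\<And>k i. Y k i \<subseteq> \<Omega> i" "\<And>k. summable (\<lambda>i. real (card (Y k i)) / real (card (\<Omega> i)))"
    "\<And>k c. c \<in> X k \<Longrightarrow> \<exists>\<^sub>\<infinity>i. c i \<in> Y k i" using X unfolding limsup_null_def by metis
  define a where "a k i = real (card (Y k i)) / real (card (\<Omega> i))" for k i
  have a0: "a k i \<ge> 0" for k i by (simp add: a_def)
  have "\<exists>m\<ge>k. \<forall>n. (\<Sum>i\<in>{m..<n}. a k i) \<le> (1/2) ^ k" for k
  proof -
    have s: "summable (a k)" using Y(2)[of k] by (simp add: a_def[abs_def])
    obtain m where m: "\<And>p n. m \<le> p \<Longrightarrow> norm (sum (a k) {p..<n}) < (1/2) ^ k"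
      using s[unfolded summable_Cauchy, rule_format, of "(1/2) ^ k"] by auto
    then have "\<forall>n. (\<Sum>i\<in>{max m k..<n}. a k i) \<le> (1/2) ^ k"
      using m[of "max m k"] by (auto simp: real_norm_def abs_if split: if_splits intro: less_imp_le) (smt (verit) max.cobounded1 sum_nonneg a0)
    then show ?thesis by (metis max.cobounded2)
  qed
  then obtain m where m: "\<And>k. m k \<ge> k" "\<And>k n. (\<Sum>i\<in>{m k..<n}. a k i) \<le> (1/2) ^ k" by metis
  define Z where "Z i = (\<Union>k\<in>{k. k \<le> i \<and> m k \<le> i}. Y k i)" for i
  have cZ: "real (card (Z i)) / real (card (\<Omega> i)) \<le> (\<Sum>k\<in>{k. k \<le> i \<and> m k \<le> i}. a k i)" for i
  proof -
    have "card (Z i) \<le> (\<Sum>k\<in>{k. k \<le> i \<and> m k \<le> i}. card (Y k i))" unfolding Z_def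
      by (rule card_UN_le) auto
    then have "real (card (Z i)) / real (card (\<Omega> i)) \<le> (\<Sum>k\<in>{k. k \<le> i \<and> m k \<le> i}. real (card (Y k i))) / real (card (\<Omega> i))"
      by (intro divide_right_mono) (simp_all flip: of_nat_sum)
    then show ?thesis by (simp add: a_def sum_divide_distrib)
  qed
  have "summable (\<lambda>i. real (card (Z i)) / real (card (\<Omega> i)))"
  proof (rule bounded_imp_summable[where B = 2])
    fix n
    have "(\<Sum>i\<le>n. real (card (Z i)) / real (card (\<Omega> i))) \<le> (\<Sum>i\<le>n. \<Sum>k\<in>{k. k \<le> i \<and> m k \<le> i}. a k i)"
      by (intro sum_mono cZ)
    also have "\<dots> = (\<Sum>i\<le>n. \<Sum>k\<le>n. if m k \<le> i then a k i else 0)"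
    proof (rule sum.cong[OF refl])
      fix i assume "i \<in> {..n}"
      then have "{k. k \<le> i \<and> m k \<le> i} = {k \<in> {..n}. m k \<le> i}" using m(1) by (auto intro: order_trans)
      then show "(\<Sum>k\<in>{k. k \<le> i \<and> m k \<le> i}. a k i) = (\<Sum>k\<le>n. if m k \<le> i then a k i else 0)"
        by (simp only: sum.inter_filter finite_atMost)
    qed
    also have "\<dots> = (\<Sum>k\<le>n. \<Sum>i\<le>n. if m k \<le> i then a k i else 0)" by (rule sum.swap)
    also have "\<dots> = (\<Sum>k\<le>n. \<Sum>i\<in>{m k..<Suc n}. a k i)"
    proof (rule sum.cong[OF refl])
      fix k
      have "{i \<in> {..n}. m k \<le> i} = {m k..<Suc n}" by auto
      then show "(\<Sum>i\<le>n. if m k \<le> i then a k i else 0) = (\<Sum>i\<in>{m k..<Suc n}. a k i)"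
        by (metis finite_atMost sum.inter_filter)
    qed
    also have "\<dots> \<le> (\<Sum>k\<le>n. (1/2) ^ k)" by (intro sum_mono m(2))
    also have "\<dots> \<le> (\<Sum>k. (1/2 :: real) ^ k)" by (intro sum_le_suminf) (auto simp: summable_geometric)
    also have "\<dots> = 2" by (simp add: suminf_geometric)
    finally show "(\<Sum>i\<le>n. real (card (Z i)) / real (card (\<Omega> i))) \<le> 2" .
  qed simp
  moreover have "\<exists>\<^sub>\<infinity>i. c i \<in> Z i" if c: "c \<in> (\<Union>k. X k)" for c
  proof -
    obtain k where "c \<in> X k" using c by auto
    then have "\<exists>\<^sub>\<infinity>i. c i \<in> Y k i" by (rule Y(3))
    then have "\<exists>\<^sub>\<infinity>i. c i \<in> Y k i \<and> m k \<le> i" 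
      by (simp add: INFM_nat_le) (meson le_trans nat_le_linear)
    then show ?thesis by (rule INFM_mono) (use m(1) in \<open>auto simp: Z_def intro: order_trans\<close>)
  qed
  moreover have "Z i \<subseteq> \<Omega> i" for i using Y(1) unfolding Z_def by blast
  ultimately show ?thesis unfolding limsup_null_def by blast
qed

lemma limsup_null_countable_UN:
  assumes "\<And>i. finite (\<Omega> i)" "countable I" "\<And>k. k \<in> I \<Longrightarrow> limsup_null \<Omega> (X k)"
  shows "limsup_null \<Omega> (\<Union>k\<in>I. X k)"
proof (cases "I = {}")
  case True
  then show ?thesis by (auto simp: limsup_null_def intro!: exI[of _ "\<lambda>_. {}"])
next
  case False
  have "limsup_null \<Omega> (\<Union>n. X (from_nat_into I n))"
    by (intro limsup_null_UN assms(1,3) from_nat_into False)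
  moreover have "(\<Union>n. X (from_nat_into I n)) = (\<Union>k\<in>I. X k)"
    using range_from_nat_into[OF False assms(2)] by (metis image_image)
  ultimately show ?thesis by simp
qed

subsection \<open>The chain condition\<close>

text \<open>A maximal antichain among the conditions compatible with only countably many
  \<open>p i\<close> is countable, so some \<open>p j\<close> is incompatible with all its members.
  Every condition below \<open>p j\<close> is then compatible with uncountably many
  \<open>p i\<close>, and extending step by step always finds a fresh index.\<close>

lemma ccc_common_extension:
  fixes p :: "'i \<Rightarrow> 'p::order"
  assumes ccc: "ccc P" and p: "\<And>i. p i \<in> P" and unc: "uncountable (UNIV :: 'i set)"
  shows "\<exists>K r. finite K \<and> card K = n \<and> r \<in> P \<and> (\<forall>i\<in>K. r \<le> p i)"
proof -
  define C where "C q = {i. \<not> incompatible P q (p i)}" for q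
  define Q where "Q = {q\<in>P. countable (C q)}"
  define \<X> where "\<X> = {X. X \<subseteq> Q \<and> antichain_in P X}"
  have "\<exists>M\<in>\<X>. \<forall>X\<in>\<X>. M \<subseteq> X \<longrightarrow> X = M"
  proof (rule subset_Zorn')
    fix \<C> assume "subset.chain \<X> \<C>"
    then have ch: "\<C> \<subseteq> \<X>" "\<And>X Y. X \<in> \<C> \<Longrightarrow> Y \<in> \<C> \<Longrightarrow> X \<subseteq> Y \<or> Y \<subseteq> X"
      by (auto simp: subset_chain_def)
    show "\<Union>\<C> \<in> \<X>"
      unfolding \<X>_def antichain_in_def mem_Collect_eq
    proof (intro conjI pairwiseI)
      show "\<Union>\<C> \<subseteq> Q" "\<Union>\<C> \<subseteq> P" using ch(1) by (auto simp: \<X>_def antichain_in_def)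
      fix a b assume ab: "a \<in> \<Union>\<C>" "b \<in> \<Union>\<C>" "a \<noteq> b"
      then obtain X where "X \<in> \<C>" "a \<in> X" "b \<in> X" using ch(2) by blast
      then show "incompatible P a b" using ch(1) ab(3) by (auto simp: \<X>_def antichain_in_def pairwise_def)
    qed
  qed
  then obtain M where M: "M \<subseteq> Q" "antichain_in P M" "\<And>X. X \<subseteq> Q \<Longrightarrow> antichain_in P X \<Longrightarrow> M \<subseteq> X \<Longrightarrow> X = M"
    unfolding \<X>_def by auto
  have "countable M" using ccc M(2) by (auto simp: ccc_def)
  then have "countable (\<Union>q\<in>M. C q)" using M(1) by (auto simp: Q_def)
  then obtain j where j: "j \<notin> (\<Union>q\<in>M. C q)" using unc by (metis UNIV_eq_I)
  \<comment> \<open>Otherwise \<open>q\<close> is in \<open>Q\<close> and, being below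
    \<open>p j\<close>, incompatible with all of \<open>M\<close>; maximality puts \<open>q\<close>
    into \<open>M\<close>, where it would be incompatible with itself.\<close>
  have big: "uncountable (C q)" if "q \<in> P" "q \<le> p j" for q
  proof
    assume "countable (C q)"
    then have qQ: "q \<in> Q" using that by (simp add: Q_def)
    have inc: "incompatible P q' q" if "q' \<in> M" for q'
    proof -
      have "incompatible P q' (p j)" using j that by (auto simp: C_def)
      then show ?thesis using \<open>q \<le> p j\<close> by (auto simp: incompatible_def intro: order_trans)
    qed
    then have "antichain_in P (insert q M)" using M(2) that
      by (auto simp: antichain_in_def pairwise_insert incompatible_def)
    then have "q \<in> M" using M(3)[of "insert q M"] M(1) qQ by auto
    then show False using inc[of q] that by (auto simp: incompatible_def)
  qed
  have "\<exists>K r. finite K \<and> card K = n \<and> r \<in> P \<and> r \<le> p j \<and> (\<forall>i\<in>K. r \<le> p i)"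
  proof (induction n)
    case 0
    show ?case by (rule exI[of _ "{}"]) (auto simp: p intro!: exI[of _ "p j"])
  next
    case (Suc n)
    then obtain K r where K: "finite K" "card K = n" "r \<in> P" "r \<le> p j" "\<forall>i\<in>K. r \<le> p i" by auto
    have "\<not> C r \<subseteq> K" using big[OF K(3,4)] K(1) countable_finite countable_subset by blast
    then obtain i where i: "i \<notin> K" "i \<in> C r" by auto
    then obtain r' where "r' \<in> P" "r' \<le> r" "r' \<le> p i" by (auto simp: C_def incompatible_def)
    then show ?case using K i
      by (intro exI[of _ "insert i K"] exI[of _ r']) (auto intro: order_trans)
  qed
  then show ?thesis by blast
qed

lemma uncountable_nat_bool: "uncountable (UNIV :: (nat \<Rightarrow> bool) set)"
proof
  assume "countable (UNIV :: (nat \<Rightarrow> bool) set)"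
  then obtain h :: "nat \<Rightarrow> nat \<Rightarrow> bool" where "range h = UNIV"
    by (metis UNIV_not_empty range_from_nat_into)
  then obtain n where "h n = (\<lambda>k. \<not> h k k)" by (metis UNIV_I imageE)
  then show False by metis
qed

subsection \<open>Cantor schemes\<close>

text \<open>\<open>R\<close> compares whole stages, so requirements can concern several words of one
  length jointly. By the last conclusion the stages along a branch \<open>F\<close> converge to the
  point \<open>x F\<close>.\<close>

lemma cantor_scheme:
  fixes R :: "nat \<Rightarrow> (bool list \<Rightarrow> 'a list) \<Rightarrow> (bool list \<Rightarrow> 'a list) \<Rightarrow> bool"
  assumes init: "s0 \<in> G"
    and step: "\<And>l S. (\<And>\<sigma>. length \<sigma> = l \<Longrightarrow> S \<sigma> \<in> G) \<Longrightarrow>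
      \<exists>S'. (\<forall>\<sigma>. length \<sigma> = Suc l \<longrightarrow> S' \<sigma> \<in> G \<and> prefix (S (take l \<sigma>)) (S' \<sigma>) \<and> l < length (S' \<sigma>)) \<and> R l S S'"
  obtains S x where "\<And>l \<sigma>. length \<sigma> = l \<Longrightarrow> S l \<sigma> \<in> G" "\<And>l. R l (S l) (S (Suc l))"
    "\<And>l \<sigma>. length \<sigma> = l \<Longrightarrow> l \<le> length (S l \<sigma>)"
    "\<And>F l. S l (map F [0..<l]) = map (x F) [0..<length (S l (map F [0..<l]))]"
proof -
  define Pr where "Pr l S \<longleftrightarrow> (\<forall>\<sigma>. length \<sigma> = l \<longrightarrow> S \<sigma> \<in> G \<and> l \<le> length (S \<sigma>))" for l and S :: "bool list \<Rightarrow> 'a list"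
  define Qr where "Qr l S S' \<longleftrightarrow> R l S S' \<and> (\<forall>\<sigma>. length \<sigma> = Suc l \<longrightarrow> prefix (S (take l \<sigma>)) (S' \<sigma>))" for l S S'
  have "\<exists>S. \<forall>l. Pr l (S l) \<and> Qr l (S l) (S (Suc l))"
  proof (rule dependent_nat_choice[where P = Pr and Q = Qr])
    show "\<exists>S. Pr 0 S" using init by (intro exI[of _ "\<lambda>_. s0"]) (simp add: Pr_def)
  next
    fix S l assume "Pr l S"
    then obtain S' where S': "\<forall>\<sigma>. length \<sigma> = Suc l \<longrightarrow> S' \<sigma> \<in> G \<and> prefix (S (take l \<sigma>)) (S' \<sigma>) \<and> l < length (S' \<sigma>)"
        "R l S S'"
      using step[of l S] unfolding Pr_def by blast
    then show "\<exists>S'. Pr (Suc l) S' \<and> Qr l S S'" by (intro exI[of _ S']) (auto simp: Pr_def Qr_def)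
  qed
  then obtain S where S: "\<And>l. Pr l (S l)" "\<And>l. Qr l (S l) (S (Suc l))" by blast
  define b where "b F l = S l (map F [0..<l])" for F l
  \<comment> \<open>Stage \<open>Suc j\<close> has length at least \<open>Suc j\<close>, so entry
    \<open>j\<close> exists there and never changes afterwards.\<close>
  define x where "x F j = b F (Suc j) ! j" for F j
  have len: "l \<le> length (b F l)" for F l using S(1)[of l] by (auto simp: Pr_def b_def)
  have pre1: "prefix (b F l) (b F (Suc l))" for F l
  proof -
    have "take l (map F [0..<Suc l]) = map F [0..<l]" by (simp add: take_map)
    then show ?thesis using S(2)[of l] unfolding Qr_def b_def by (metis length_map length_upt minus_nat.diff_0)
  qed
  have pre: "prefix (b F l) (b F l')" if "l \<le> l'" for F l l'
    using that by (induction rule: dec_induct) (auto intro: pre1 prefix_order.trans)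
  have "b F l = map (x F) [0..<length (b F l)]" for F l
  proof (rule nth_equalityI)
    fix j assume j: "j < length (b F l)"
    have "b F l ! j = b F (Suc j) ! j"
    proof (cases "l \<le> Suc j")
      case True
      then show ?thesis using pre[OF True, of F] j by (auto simp: prefix_def nth_append)
    next
      case False
      then show ?thesis using pre[of "Suc j" l F] len[of "Suc j" F] by (auto simp: prefix_def nth_append)
    qed
    then show "b F l ! j = map (x F) [0..<length (b F l)] ! j" using j by (simp add: x_def)
  qed simp
  then show ?thesis using that[of S x] S unfolding b_def Pr_def Qr_def by blast
qed

subsection \<open>Nodes with extensions at every level\<close>

text \<open>For trees with finite levels these are, by Koenig's lemma, the nodes of length
  \<open>n\<close> on branches. Intersecting projections lets a single deeper level determine the
  set.\<close>

definition core :: "nat list set \<Rightarrow> nat \<Rightarrow> nat list set" where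
  "core S n = (\<Inter>L\<in>{n..}. take n ` level S L)"

lemma finite_seq_level: "finite {s \<in> seq f. length s = n}"
proof (rule finite_subset)
  show "{s \<in> seq f. length s = n} \<subseteq> {s. set s \<subseteq> {..<\<Sum>i<n. f i} \<and> length s = n}"
  proof safe
    fix s x assume s: "s \<in> seq f" "x \<in> set s" "n = length s"
    then obtain i where i: "i < length s" "x = s ! i" by (auto simp: in_set_conv_nth)
    have "x < f i" using s(1) i by (auto simp: seq_def)
    also have "f i \<le> (\<Sum>i<length s. f i)" using i by (intro member_le_sum) auto
    finally show "x < (\<Sum>i<length s. f i)" .
  qed
qed (rule finite_lists_length_eq, simp)

lemma finite_level: "S \<in> trees f \<Longrightarrow> finite (level S n)"
  by (rule finite_subset[OF _ finite_seq_level[of f n]]) (auto simp: level_def trees_def)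

lemma take_level_antimono:
  assumes "down_closed S" "n \<le> L" "L \<le> L'"
  shows "take n ` level S L' \<subseteq> take n ` level S L"
proof
  fix y assume "y \<in> take n ` level S L'"
  then obtain s where s: "s \<in> S" "length s = L'" "y = take n s" by (auto simp: level_def)
  have "take L s \<in> level S L" using assms s by (auto simp: down_closed_def level_def take_is_prefix)
  moreover have "y = take n (take L s)" using assms s by (simp add: min_def)
  ultimately show "y \<in> take n ` level S L" by blast
qed

lemma core_subset_take_level: "n \<le> L \<Longrightarrow> core S n \<subseteq> take n ` level S L"
  by (auto simp: core_def)

lemma core_subset_level: "core S n \<subseteq> level S n"
  using core_subset_take_level[of n n S] by (auto simp: level_def)

lemma finite_core: "S \<in> trees f \<Longrightarrow> finite (core S n)"
  using core_subset_level finite_level by (rule finite_subset)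

lemma core_mono: "S \<subseteq> S' \<Longrightarrow> core S n \<subseteq> core S' n"
  unfolding core_def level_def by (intro INF_mono) blast

text \<open>The projections form a decreasing sequence of finite sets; one of least cardinality is
  their intersection.\<close>

lemma core_eq_take_level:
  assumes "S \<in> trees f"
  obtains L where "L \<ge> n" "core S n = take n ` level S L"
proof -
  have dc: "down_closed S" using assms by (simp add: trees_def)
  obtain L where L: "n \<le> L" "\<And>L'. n \<le> L' \<Longrightarrow> card (take n ` level S L) \<le> card (take n ` level S L')"
    using ex_has_least_nat[of "\<lambda>L. n \<le> L" n "\<lambda>L. card (take n ` level S L)"] by auto
  have "take n ` level S L \<subseteq> take n ` level S L'" if "n \<le> L'" for L'
  proof (cases "L' \<le> L")
    case True
    then show ?thesis using take_level_antimono[OF dc] that by blast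
  next
    case False
    then have "take n ` level S L' \<subseteq> take n ` level S L" using take_level_antimono[OF dc L(1)] by simp
    then have "take n ` level S L' = take n ` level S L"
      using L(2)[OF that] finite_level[OF assms] by (intro card_seteq) auto
    then show ?thesis by simp
  qed
  then have "core S n = take n ` level S L" using L(1) by (auto simp: core_def)
  with L(1) show ?thesis using that by blast
qed

text \<open>Every node of the core at \<open>n\<close> extends to one at \<open>m\<close>. Levels
  themselves may shrink because of dead ends.\<close>

lemma card_core_mono:
  assumes "S \<in> trees f" "n \<le> m"
  shows "card (core S n) \<le> card (core S m)"
proof -
  obtain L where L: "L \<ge> m" "core S m = take m ` level S L" using core_eq_take_level[OF assms(1)] .
  have "core S n \<subseteq> take n ` level S L" using L assms by (intro core_subset_take_level) simp
  also have "\<dots> = take n ` core S m" using assms(2) by (simp add: L(2) image_image min_def)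
  finally have "card (core S n) \<le> card (take n ` core S m)" using finite_core[OF assms(1)] by (intro card_mono) auto
  also have "\<dots> \<le> card (core S m)" using finite_core[OF assms(1)] by (rule card_image_le)
  finally show ?thesis .
qed

lemma branch_level:
  assumes S: "S \<in> trees f" and B: "B \<in> branches S"
  shows "\<exists>s\<in>B. length s = n" and "\<And>s s'. s \<in> B \<Longrightarrow> s' \<in> B \<Longrightarrow> length s \<le> length s' \<Longrightarrow> s = take (length s) s'"
proof -
  have B': "B \<subseteq> seq f" "infinite B" "down_closed B" "Complete_Partial_Order.chain prefix B"
    using S B by (auto simp: branches_def trees_def)
  have "finite (\<Union>k\<in>{..n}. {s \<in> seq f. length s = k})" using finite_seq_level by auto
  then have "\<not> B \<subseteq> (\<Union>k\<in>{..n}. {s \<in> seq f. length s = k})" using B'(2) finite_subset by blast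
  then obtain s where s: "s \<in> B" "length s > n" using B'(1) by force
  then have "take n s \<in> B" using B'(3) by (auto simp: down_closed_def take_is_prefix)
  then show "\<exists>s\<in>B. length s = n" using s(2) by (intro bexI[of _ "take n s"]) auto
  show "s = take (length s) s'" if ss: "s \<in> B" "s' \<in> B" "length s \<le> length s'" for s s'
  proof -
    have "prefix s s' \<or> prefix s' s" using B'(4) ss by (auto simp: chain_def)
    then show ?thesis using ss(3) by (auto simp: prefix_def)
  qed
qed

text \<open>Any \<open>k\<close> branches are pairwise different from some length on, and their
  nodes lie in the core.\<close>

lemma eventually_card_core_ge:
  assumes S: "S \<in> trees f" and inf: "infinitely_branching S"
  shows "\<forall>\<^sub>\<infinity>n. k \<le> card (core S n)"
proof -
  obtain \<B> where \<B>: "\<B> \<subseteq> branches S" "finite \<B>" "card \<B> = k"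
    using inf infinite_arbitrarily_large unfolding infinitely_branching_def by metis
  define e where "e B n = (SOME s. s \<in> B \<and> length s = n)" for B :: "nat list set" and n
  have e: "e B n \<in> B" "length (e B n) = n" if "B \<in> \<B>" for B n
    using branch_level(1)[OF S, of B n] that \<B>(1) someI_ex[of "\<lambda>s. s \<in> B \<and> length s = n"]
    unfolding e_def by blast+
  have eu: "s = e B (length s)" if "B \<in> \<B>" "s \<in> B" for B s
    using branch_level(2)[OF S, of B s "e B (length s)"] that \<B>(1) e[OF that(1), of "length s"] by auto
  have et: "e B n = take n (e B m)" if "B \<in> \<B>" "n \<le> m" for B n m
    using branch_level(2)[OF S, of B "e B n" "e B m"] that \<B>(1) e[OF that(1)] by auto
  have in_core: "e B n \<in> core S n" if "B \<in> \<B>" for B n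
    unfolding core_def
  proof
    fix L assume "L \<in> {n..}"
    then have "e B n = take n (e B L)" using et that by simp
    moreover have "e B L \<in> level S L" using e[OF that] \<B>(1) that by (auto simp: level_def branches_def)
    ultimately show "e B n \<in> take n ` level S L" by blast
  qed
  have ne: "\<forall>\<^sub>\<infinity>n. B \<noteq> B' \<longrightarrow> e B n \<noteq> e B' n" if BB: "B \<in> \<B>" "B' \<in> \<B>" for B B'
  proof (rule ccontr)
    assume "\<not> ?thesis"
    then have neq: "B \<noteq> B'" and inf': "\<And>n. \<exists>m>n. e B m = e B' m"
      by (auto simp: MOST_nat)
    have same: "e B n = e B' n" for n
    proof -
      obtain m where "m > n" "e B m = e B' m" using inf' by blast
      then show ?thesis using et[OF BB(1), of n m] et[OF BB(2), of n m] by simp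
    qed
    have "B = B'" using eu[OF BB(1)] eu[OF BB(2)] e(1)[OF BB(1)] e(1)[OF BB(2)] same by (metis subsetI subset_antisym)
    with neq show False by simp
  qed
  then have "\<forall>\<^sub>\<infinity>n. \<forall>B\<in>\<B>. \<forall>B'\<in>\<B>. B \<noteq> B' \<longrightarrow> e B n \<noteq> e B' n"
    unfolding cofinite_eq_sequentially using \<B>(2) by (intro eventually_ball_finite ballI) auto
  then show ?thesis
  proof (rule MOST_mono)
    fix n assume "\<forall>B\<in>\<B>. \<forall>B'\<in>\<B>. B \<noteq> B' \<longrightarrow> e B n \<noteq> e B' n"
    then have "inj_on (\<lambda>B. e B n) \<B>" by (auto simp: inj_on_def)
    then have "k = card ((\<lambda>B. e B n) ` \<B>)" using \<B>(3) by (simp add: card_image)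
    also have "\<dots> \<le> card (core S n)" using in_core finite_core[OF S] by (intro card_mono) auto
    finally show "k \<le> card (core S n)" .
  qed
qed

lemma INFM_subseq: "strict_mono (r :: nat \<Rightarrow> nat) \<Longrightarrow> \<exists>\<^sub>\<infinity>i. Q (r i) \<Longrightarrow> \<exists>\<^sub>\<infinity>i. Q i"
  unfolding INFM_nat_le by (meson order_trans seq_suble)

lemma INFM_shift: "\<exists>\<^sub>\<infinity>i. Q i \<Longrightarrow> \<exists>\<^sub>\<infinity>i. Q (k + i :: nat)"
  unfolding INFM_nat_le
proof
  fix m assume "\<forall>m. \<exists>n\<ge>m. Q n"
  then obtain n where n: "n \<ge> m + k" "Q n" by blast
  then have "k + (n - k) = n" "n - k \<ge> m" by auto
  then show "\<exists>n\<ge>m. Q (k + n)" using n(2) by metis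
qed

subsection \<open>Families without a good colouring\<close>

text \<open>The setting of the contradiction: \<open>g\<close> parametrises the family by the Baire
  space, with continuity expressed as local constancy of levels; \<open>bad\<close> denies the
  conclusion for every colouring; \<open>\<psi>\<close> is one growth rate valid for all subtrees of
  \<open>T\<close>.\<close>

locale bad_family =
  fixes f :: "nat \<Rightarrow> nat" and \<A> :: "nat list set set" and T :: "nat list set"
    and g :: "(nat \<Rightarrow> nat) \<Rightarrow> nat list set" and \<psi> :: "nat \<Rightarrow> real"
  assumes A_trees: "\<A> \<subseteq> trees f"
    and T_in: "T \<in> \<A>"
    and branching: "\<And>S. S \<in> \<A> \<Longrightarrow> infinitely_branching S"
    and ccc_A: "ccc \<A>"
    and range_g: "range g = \<A>"
    and level_locally_constant: "\<And>x L. \<exists>l. \<forall>x'. (\<forall>j<l. x' j = x j) \<longrightarrow> level (g x') L = level (g x) L"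
    and bad: "\<And>c T'. c \<in> seq f \<rightarrow> {0, 1 :: nat} \<Longrightarrow> T' \<in> \<A> \<Longrightarrow>
                \<exists>S\<in>\<A>. S \<subseteq> T' \<and> (\<exists>\<^sub>\<infinity>n. homogeneous c (level S n))"
    and \<psi>_top: "filterlim \<psi> at_top sequentially"
    and \<psi>_le: "\<And>S. S \<in> \<A> \<Longrightarrow> S \<subseteq> T \<Longrightarrow> \<forall>\<^sub>\<infinity>n. \<psi> n \<le> real (card (level S n))"
begin

lemma g_tree: "g x \<in> trees f" and g_in: "g x \<in> \<A>"
  using range_g A_trees by auto

text \<open>Basic open sets of the Baire space, cut down to codes of subtrees of \<open>T\<close>,
  the trees whose growth is controlled.\<close>

definition cyl :: "nat list \<Rightarrow> (nat \<Rightarrow> nat) set" where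
  "cyl s = {x. g x \<subseteq> T \<and> map x [0..<length s] = s}"

lemma cyl_map_iff: "x \<in> cyl (map x [0..<l]) \<longleftrightarrow> g x \<subseteq> T"
  by (simp add: cyl_def)

lemma prefix_map_upt: "l \<le> l' \<Longrightarrow> prefix (map x [0..<l]) (map x [0..<l'])"
  by (metis le_add_diff_inverse map_mono_prefix prefixI upt_add_eq_append zero_le)

lemma cyl_antimono: "prefix s s' \<Longrightarrow> cyl s' \<subseteq> cyl s"
proof
  fix x assume p: "prefix s s'" and x: "x \<in> cyl s'"
  then have "take (length s) (map x [0..<length s']) = s" by (auto simp: cyl_def prefix_def)
  then have "map x [0..<length s] = s" using prefix_length_le[OF p] by (simp add: take_map)
  then show "x \<in> cyl s" using x by (simp add: cyl_def)
qed

text \<open>Being a subtree of \<open>T\<close> is a closed condition on codes: each node of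
  \<open>g x\<close> occurs in \<open>g x'\<close> for all nearby \<open>x'\<close>.\<close>

lemma g_subset_if_cyl_nonempty:
  assumes "\<And>l. cyl (map x [0..<l]) \<noteq> {}"
  shows "g x \<subseteq> T"
proof
  fix s assume s: "s \<in> g x"
  obtain l where l: "\<forall>x'. (\<forall>j<l. x' j = x j) \<longrightarrow> level (g x') (length s) = level (g x) (length s)"
    using level_locally_constant by blast
  obtain x' where x': "x' \<in> cyl (map x [0..<l])" using assms by blast
  then have "\<forall>j<l. x' j = x j" by (auto simp: cyl_def)
  then have "s \<in> g x'" using l s by (auto simp: level_def)
  then show "s \<in> T" using x' by (auto simp: cyl_def)
qed

text \<open>Upper semicontinuity: the core of \<open>g x\<close> at \<open>n\<close> is the
  projection of one level, which nearby codes share, and their cores lie in that projection.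
  Equality can fail, as nearby trees may die out at deeper levels.\<close>

lemma core_locally_decreasing:
  "\<forall>\<^sub>F l in sequentially. \<forall>x'\<in>cyl (map x [0..<l]). \<forall>n\<le>M. core (g x') n \<subseteq> core (g x) n"
proof -
  have "\<forall>\<^sub>F l in sequentially. \<forall>x'\<in>cyl (map x [0..<l]). core (g x') n \<subseteq> core (g x) n" for n
  proof -
    obtain L where L: "L \<ge> n" "core (g x) n = take n ` level (g x) L" using core_eq_take_level[OF g_tree] .
    obtain l where l: "\<forall>x'. (\<forall>j<l. x' j = x j) \<longrightarrow> level (g x') L = level (g x) L"
      using level_locally_constant by blast
    have "core (g x') n \<subseteq> core (g x) n" if "l \<le> l'" "x' \<in> cyl (map x [0..<l'])" for l' x'
    proof -
      have "\<forall>j<l. x' j = x j" using that by (auto simp: cyl_def)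
      then have "level (g x') L = level (g x) L" using l by blast
      then show ?thesis using core_subset_take_level[OF L(1), of "g x'"] L(2) by simp
    qed
    then show ?thesis by (auto simp: eventually_sequentially)
  qed
  then have "\<forall>\<^sub>F l in sequentially. \<forall>n\<in>{..M}. \<forall>x'\<in>cyl (map x [0..<l]). core (g x') n \<subseteq> core (g x) n"
    by (intro eventually_ball_finite) auto
  then show ?thesis by (rule eventually_mono) auto
qed

text \<open>\<open>I\<close> plays the role of a sigma-ideal; words are countable, so deleting all
  small cylinders deletes only a small set. Points of the kernel have only positive neighbourhoods,
  which lets a construction continue inside it.\<close>

lemma kernel_positive:
  fixes G :: "nat list set"
  assumes mono: "\<And>X Y. I Y \<Longrightarrow> X \<subseteq> Y \<Longrightarrow> I X"
    and UN: "\<And>J (F :: nat list \<Rightarrow> (nat \<Rightarrow> nat) set). (\<And>s. s \<in> J \<Longrightarrow> I (F s)) \<Longrightarrow> I (\<Union>s\<in>J. F s)"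
    and nG: "\<And>s. s \<notin> G \<Longrightarrow> I (cyl s)"
    and s: "\<not> I (cyl s)"
  shows "\<not> I {x \<in> cyl s. \<forall>l. map x [0..<l] \<in> G}"
proof
  let ?K = "{x \<in> cyl s. \<forall>l. map x [0..<l] \<in> G}"
  assume K: "I ?K"
  define F where "F s' = (if s' \<in> G then ?K else cyl s')" for s'
  have "I (\<Union>s'\<in>UNIV. F s')" by (rule UN) (use K nG in \<open>auto simp: F_def\<close>)
  moreover have "cyl s \<subseteq> (\<Union>s'\<in>UNIV. F s')"
  proof
    fix x assume x: "x \<in> cyl s"
    show "x \<in> (\<Union>s'\<in>UNIV. F s')"
    proof (cases "\<forall>l. map x [0..<l] \<in> G")
      case True
      then have "x \<in> F (map x [0..<0])" using x unfolding F_def by (simp only: if_True) simp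
      then show ?thesis by blast
    next
      case False
      then obtain l where "map x [0..<l] \<notin> G" by blast
      then have "x \<in> F (map x [0..<l])" using x cyl_map_iff by (simp add: F_def) (simp add: cyl_def)
      then show ?thesis by blast
    qed
  qed
  ultimately show False using mono s by blast
qed

definition large :: "nat list set \<Rightarrow> nat \<Rightarrow> bool" where
  "large U n \<longleftrightarrow> \<psi> n \<le> real (card (core U n))"

lemma core_nonempty: "S \<in> \<A> \<Longrightarrow> core S n \<noteq> {}"
proof
  assume S: "S \<in> \<A>" and e: "core S n = {}"
  have tr: "S \<in> trees f" using S A_trees by auto
  obtain L where L: "core S n = take n ` level S L" using core_eq_take_level[OF tr] .
  obtain m0 where m0: "\<And>m. m \<ge> m0 \<Longrightarrow> 1 \<le> card (core S m)"
    using eventually_card_core_ge[OF tr branching[OF S], of 1] by (auto simp: MOST_nat_le)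
  have "core S (max L m0) \<noteq> {}" using m0[of "max L m0"] by auto
  then obtain s where "s \<in> level S (max L m0)" using core_subset_level by blast
  then have "take L s \<in> level S L" using tr by (auto simp: trees_def level_def down_closed_def take_is_prefix)
  then show False using L e by auto
qed

text \<open>Colouring the nodes of \<open>U\<close> by membership in the core forces some level of a smaller tree into
  the core, because a level of a smaller tree always meets the core.\<close>

lemma infinitely_often_large:
  assumes U: "U \<in> \<A>" "U \<subseteq> T"
  shows "\<exists>\<^sub>\<infinity>n. large U n"
proof -
  define c :: "nat list \<Rightarrow> nat" where "c s = (if s \<in> core U (length s) then 1 else 0)" for s
  have "c \<in> seq f \<rightarrow> {0, 1}" by (auto simp: c_def)
  then obtain S where S: "S \<in> \<A>" "S \<subseteq> U" "\<exists>\<^sub>\<infinity>n. homogeneous c (level S n)" using bad U(1) by blast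
  have "\<exists>\<^sub>\<infinity>n. \<psi> n \<le> real (card (level S n)) \<and> homogeneous c (level S n)"
    using S(3) \<psi>_le[OF S(1)] S(2) U(2) by (intro frequently_eventually_conj) auto
  then show ?thesis
  proof (rule INFM_mono)
    fix n assume n: "\<psi> n \<le> real (card (level S n)) \<and> homogeneous c (level S n)"
    obtain s where s: "s \<in> core S n" using core_nonempty[OF S(1)] by blast
    then have "s \<in> level S n" "s \<in> core U n" using core_subset_level core_mono[OF S(2)] by blast+
    then have "c s = 1" by (simp add: c_def level_def)
    then have "level S n \<subseteq> core U n"
      using n \<open>s \<in> level S n\<close> by (auto simp: homogeneous_def constant_on_def c_def level_def split: if_splits)
    then have "card (level S n) \<le> card (core U n)" using finite_core[of U f] A_trees U(1) by (intro card_mono) auto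
    then show "large U n" using n by (simp add: large_def)
  qed
qed

text \<open>\<open>k\<close> is common to all codes in \<open>X\<close>, while the exceptional
  \<open>n\<close> may depend on \<open>x\<close>; this makes the property a sigma-ideal.\<close>

definition large_bounded :: "(nat \<Rightarrow> nat) set \<Rightarrow> bool" where
  "large_bounded X \<longleftrightarrow> (\<exists>k. \<forall>x\<in>X. \<forall>\<^sub>\<infinity>n. \<exists>m\<in>{n..k n}. large (g x) m)"

lemma large_bounded_subset: "large_bounded Y \<Longrightarrow> X \<subseteq> Y \<Longrightarrow> large_bounded X"
  unfolding large_bounded_def by blast

text \<open>Countably many functions are eventually dominated by one: \<open>k' n\<close> is the
  maximum over the words numbered up to \<open>n\<close>.\<close>

lemma large_bounded_UN:
  fixes F :: "nat list \<Rightarrow> (nat \<Rightarrow> nat) set"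
  assumes "\<And>s. s \<in> J \<Longrightarrow> large_bounded (F s)"
  shows "large_bounded (\<Union>s\<in>J. F s)"
proof -
  have "\<exists>k. \<forall>s\<in>J. \<forall>x\<in>F s. \<forall>\<^sub>\<infinity>n. \<exists>m\<in>{n..k s n}. large (g x) m"
    by (rule bchoice) (use assms in \<open>auto simp: large_bounded_def\<close>)
  then obtain k where k: "\<And>s x. s \<in> J \<Longrightarrow> x \<in> F s \<Longrightarrow> \<forall>\<^sub>\<infinity>n. \<exists>m\<in>{n..k s n}. large (g x) m" by blast
  define k' where "k' n = Max ((\<lambda>j. k (from_nat j) n) ` {..n})" for n
  have "\<forall>\<^sub>\<infinity>n. \<exists>m\<in>{n..k' n}. large (g x) m" if "s \<in> J" "x \<in> F s" for s x
  proof -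
    have "\<forall>\<^sub>\<infinity>n. (\<exists>m\<in>{n..k s n}. large (g x) m) \<and> n \<ge> to_nat s"
      using k[OF that] by (intro MOST_conjI) (auto simp: MOST_nat_le)
    then show ?thesis
    proof (rule MOST_mono)
      fix n assume n: "(\<exists>m\<in>{n..k s n}. large (g x) m) \<and> to_nat s \<le> n"
      have "k s n \<le> k' n" unfolding k'_def
        by (rule Max_ge) (use n in \<open>auto intro!: image_eqI[of _ _ "to_nat s"]\<close>)
      then show "\<exists>m\<in>{n..k' n}. large (g x) m" using n by force
    qed
  qed
  then show ?thesis unfolding large_bounded_def by (intro exI[of _ k']) auto
qed

text \<open>Otherwise the Cantor scheme below produces trees with pairwise almost disjoint sets of large levels:
  a tree starts a new gap only after extending its current gap past the beginnings of the gaps of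
  all other trees. Such trees have no common extension, as that would have infinitely many large levels.\<close>

lemma large_bounded_all: "large_bounded (cyl [])"
proof (rule ccontr)
  assume nb: "\<not> large_bounded (cyl [])"
  define G where "G = {s. \<not> large_bounded (cyl s)}"
  define ker where "ker s = {x \<in> cyl s. \<forall>l. map x [0..<l] \<in> G}" for s
  have ne: "cyl s \<noteq> {}" if "s \<in> G" for s using that by (auto simp: G_def large_bounded_def)
  have ker: "\<not> large_bounded (ker s)" if "s \<in> G" for s
    unfolding ker_def
  proof (rule kernel_positive[where I = large_bounded])
    show "large_bounded X" if "large_bounded Y" "X \<subseteq> Y" for X Y using that by (rule large_bounded_subset)
    show "large_bounded (\<Union>s\<in>J. F s)" if "\<And>s. s \<in> J \<Longrightarrow> large_bounded (F s)"
      for J and F :: "nat list \<Rightarrow> (nat \<Rightarrow> nat) set" using that by (rule large_bounded_UN)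
  qed (use that in \<open>auto simp: G_def\<close>)
  \<comment> \<open>If gaps starting at each such \<open>n\<close> were bounded on the kernel, the
    bounds would form one function \<open>k\<close>. So some \<open>NS s\<close> begins gaps of
    every finite length.\<close>
  have "\<exists>n. n \<ge> length s \<and> (\<forall>M. \<exists>x\<in>ker s. \<forall>m\<in>{n..M}. \<not> large (g x) m)" if s: "s \<in> G" for s
  proof (rule ccontr)
    assume "\<not> ?thesis"
    then have "\<forall>n. \<exists>M. n \<ge> length s \<longrightarrow> (\<forall>x\<in>ker s. \<exists>m\<in>{n..M}. large (g x) m)" by blast
    then obtain k where "\<And>n. n \<ge> length s \<Longrightarrow> \<forall>x\<in>ker s. \<exists>m\<in>{n..k n}. large (g x) m" by metis
    then have "large_bounded (ker s)" unfolding large_bounded_def MOST_nat_le by blast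
    with ker[OF s] show False by simp
  qed
  then obtain NS where NS: "\<And>s. s \<in> G \<Longrightarrow> NS s \<ge> length s"
    "\<And>s M. s \<in> G \<Longrightarrow> \<exists>x\<in>ker s. \<forall>m\<in>{NS s..M}. \<not> large (g x) m" by metis
  \<comment> \<open>Upper semicontinuity makes a finite gap persist on a cylinder around the
    witness; the witness lies in the kernel, so the cylinder stays positive.\<close>
  have gap: "\<exists>s'\<in>G. prefix s s' \<and> l < length s' \<and> (\<forall>x\<in>cyl s'. \<forall>m\<in>{NS s..M}. \<not> large (g x) m)"
    if s: "s \<in> G" for s l M
  proof -
    obtain x where x: "x \<in> ker s" "\<forall>m\<in>{NS s..M}. \<not> large (g x) m" using NS(2)[OF s] by blast
    obtain l0 where l0: "\<And>l. l \<ge> l0 \<Longrightarrow> \<forall>x'\<in>cyl (map x [0..<l]). \<forall>n\<le>M. core (g x') n \<subseteq> core (g x) n"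
      using core_locally_decreasing[of x M] by (auto simp: eventually_sequentially)
    define l1 where "l1 = max l0 (max (length s) (Suc l))"
    define s' where "s' = map x [0..<l1]"
    have "prefix s s'" using x(1) prefix_map_upt[of "length s" l1 x] by (auto simp: ker_def cyl_def s'_def l1_def)
    moreover have "\<not> large (g x') m" if "x' \<in> cyl s'" "m \<in> {NS s..M}" for x' m
    proof -
      have "core (g x') m \<subseteq> core (g x) m" using l0[of l1] that by (auto simp: s'_def l1_def)
      then have "card (core (g x') m) \<le> card (core (g x) m)" using finite_core[OF g_tree] by (intro card_mono)
      then show ?thesis using x(2) that(2) by (force simp: large_def)
    qed
    moreover have "s' \<in> G" using x(1) by (auto simp: ker_def s'_def)
    ultimately show ?thesis by (intro bexI[of _ s']) (auto simp: s'_def l1_def)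
  qed
  \<comment> \<open>The old and the new minimum delimit the interval treated in one stage; the
    intervals of successive stages adjoin, so nothing is left out.\<close>
  define cov where "cov \<Sigma> S S' \<longleftrightarrow> (\<forall>\<sigma>\<in>\<Sigma>. \<forall>\<tau>\<in>\<Sigma>. \<sigma> \<noteq> \<tau> \<longrightarrow>
      (\<forall>n. min (NS (S \<sigma>)) (NS (S \<tau>)) \<le> n \<and> n < min (NS (S' \<sigma>)) (NS (S' \<tau>)) \<longrightarrow>
        (\<forall>x\<in>cyl (S' \<sigma>). \<forall>y\<in>cyl (S' \<tau>). \<not> (large (g x) n \<and> large (g y) n))))"
    for \<Sigma> :: "bool list set" and S S' :: "bool list \<Rightarrow> nat list"
  have covD: "\<not> (large (g x) n \<and> large (g y) n)"
    if "cov \<Sigma> S S'" "\<sigma> \<in> \<Sigma>" "\<tau> \<in> \<Sigma>" "\<sigma> \<noteq> \<tau>" "min (NS (S \<sigma>)) (NS (S \<tau>)) \<le> n"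
      "n < min (NS (S' \<sigma>)) (NS (S' \<tau>))" "x \<in> cyl (S' \<sigma>)" "y \<in> cyl (S' \<tau>)" for \<Sigma> S S' \<sigma> \<tau> n x y
    using that(1)[unfolded cov_def, rule_format, OF that(2-4) conjI[OF that(5,6)] that(7,8)] .
  have round: "\<exists>S'. (\<forall>\<sigma>\<in>\<Sigma>. S' \<sigma> \<in> G \<and> prefix (S \<sigma>) (S' \<sigma>) \<and> l < length (S' \<sigma>)) \<and> cov \<Sigma> S S'"
    if fin: "finite \<Sigma>" and S: "\<And>\<sigma>. \<sigma> \<in> \<Sigma> \<Longrightarrow> S \<sigma> \<in> G" for \<Sigma> S l
  proof -
    have "\<exists>S'. (\<forall>\<sigma>\<in>\<Sigma>. S' \<sigma> \<in> G \<and> prefix (S \<sigma>) (S' \<sigma>)) \<and> (\<forall>\<sigma>\<in>\<Sigma>'. l < length (S' \<sigma>)) \<and> cov \<Sigma> S S'"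
      if "\<Sigma>' \<subseteq> \<Sigma>" for \<Sigma>'
      using finite_subset[OF that fin] that
    proof (induction \<Sigma>' rule: finite_induct)
      case empty
      show ?case using S by (intro exI[of _ S]) (auto simp: cov_def)
    next
      case (insert \<rho> \<Sigma>')
      then obtain S1 where S1: "\<And>\<sigma>. \<sigma> \<in> \<Sigma> \<Longrightarrow> S1 \<sigma> \<in> G" "\<And>\<sigma>. \<sigma> \<in> \<Sigma> \<Longrightarrow> prefix (S \<sigma>) (S1 \<sigma>)"
        "\<And>\<sigma>. \<sigma> \<in> \<Sigma>' \<Longrightarrow> l < length (S1 \<sigma>)" "cov \<Sigma> S S1" by blast
      have \<rho>: "\<rho> \<in> \<Sigma>" using insert.prems by auto
      \<comment> \<open>In \<open>one\<close>, an \<open>n\<close> not treated before satisfies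
        \<open>NS (S1 \<rho>) \<le> n < NS (S1 \<tau>) \<le> M\<close>, so a gap of
        \<open>\<rho>\<close> up to \<open>M\<close> covers it.\<close>
      define M where "M = Max ((\<lambda>\<sigma>. NS (S1 \<sigma>)) ` \<Sigma>)"
      have M: "NS (S1 \<sigma>) \<le> M" if "\<sigma> \<in> \<Sigma>" for \<sigma> unfolding M_def using that fin by (intro Max_ge) auto
      obtain s' where s': "s' \<in> G" "prefix (S1 \<rho>) s'" "l < length s'"
        "\<And>x m. x \<in> cyl s' \<Longrightarrow> m \<in> {NS (S1 \<rho>)..M} \<Longrightarrow> \<not> large (g x) m" using gap[OF S1(1)[OF \<rho>]] by blast
      define S2 where "S2 = S1(\<rho> := s')"
      have one: "\<not> (large (g x) n \<and> large (g y) n)"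
        if "\<tau> \<in> \<Sigma>" "\<tau> \<noteq> \<rho>" "min (NS (S \<rho>)) (NS (S \<tau>)) \<le> n" "n < min (NS s') (NS (S1 \<tau>))"
          "x \<in> cyl s'" "y \<in> cyl (S1 \<tau>)" for \<tau> n x y
      proof (cases "n < min (NS (S1 \<rho>)) (NS (S1 \<tau>))")
        case True
        moreover have "x \<in> cyl (S1 \<rho>)" using cyl_antimono[OF s'(2)] that(5) by blast
        ultimately show ?thesis using that by (intro covD[OF S1(4) \<rho> that(1)]) auto
      next
        case False
        then have "n \<in> {NS (S1 \<rho>)..M}" using that(4) M[OF that(1)] by auto
        then show ?thesis using s'(4) that(5) by blast
      qed
      have "cov \<Sigma> S S2" unfolding cov_def
      proof (intro ballI impI allI)
        fix \<sigma> \<tau> n x y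
        assume h: "\<sigma> \<in> \<Sigma>" "\<tau> \<in> \<Sigma>" "\<sigma> \<noteq> \<tau>"
          "min (NS (S \<sigma>)) (NS (S \<tau>)) \<le> n \<and> n < min (NS (S2 \<sigma>)) (NS (S2 \<tau>))" "x \<in> cyl (S2 \<sigma>)" "y \<in> cyl (S2 \<tau>)"
        consider "\<sigma> = \<rho>" | "\<tau> = \<rho>" | "\<sigma> \<noteq> \<rho>" "\<tau> \<noteq> \<rho>" by blast
        then show "\<not> (large (g x) n \<and> large (g y) n)"
        proof cases
          case 1
          then show ?thesis using one[of \<tau> n x y] h by (simp add: S2_def)
        next
          case 2
          then show ?thesis using one[of \<sigma> n y x] h by (auto simp: S2_def min.commute)
        next
          case 3
          then have "S2 \<sigma> = S1 \<sigma>" "S2 \<tau> = S1 \<tau>" by (auto simp: S2_def)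
          then show ?thesis using h by (intro covD[OF S1(4) h(1-3)]) auto
        qed
      qed
      moreover have "S2 \<sigma> \<in> G \<and> prefix (S \<sigma>) (S2 \<sigma>)" if "\<sigma> \<in> \<Sigma>" for \<sigma>
        using S1(1,2)[OF that] s'(1,2) S1(2)[OF \<rho>] by (auto simp: S2_def)
      moreover have "l < length (S2 \<sigma>)" if "\<sigma> \<in> insert \<rho> \<Sigma>'" for \<sigma>
        using S1(3) s'(3) that by (auto simp: S2_def)
      ultimately show ?case by (intro exI[of _ S2]) blast
    qed
    from this[OF order_refl] show ?thesis by blast
  qed
  have Nil: "[] \<in> G" using nb by (simp add: G_def)
  obtain S x where Sx: "\<And>l \<sigma>. length \<sigma> = l \<Longrightarrow> S l \<sigma> \<in> G"
    "\<And>l. cov {\<sigma>. length \<sigma> = Suc l} (\<lambda>\<sigma>. S l (take l \<sigma>)) (S (Suc l))"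
    "\<And>l \<sigma>. length \<sigma> = l \<Longrightarrow> l \<le> length (S l \<sigma>)"
    "\<And>F l. S l (map F [0..<l]) = map (x F) [0..<length (S l (map F [0..<l]))]"
  proof (rule cantor_scheme[OF Nil, where R = "\<lambda>l S S'. cov {\<sigma>. length \<sigma> = Suc l} (\<lambda>\<sigma>. S (take l \<sigma>)) S'"])
    fix l and S :: "bool list \<Rightarrow> nat list"
    assume "\<And>\<sigma>. length \<sigma> = l \<Longrightarrow> S \<sigma> \<in> G"
    then show "\<exists>S'. (\<forall>\<sigma>. length \<sigma> = Suc l \<longrightarrow> S' \<sigma> \<in> G \<and> prefix (S (take l \<sigma>)) (S' \<sigma>) \<and> l < length (S' \<sigma>)) \<and>
        cov {\<sigma>. length \<sigma> = Suc l} (\<lambda>\<sigma>. S (take l \<sigma>)) S'"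
      using round[of "{\<sigma>. length \<sigma> = Suc l}" "\<lambda>\<sigma>. S (take l \<sigma>)" l] finite_lists_length_eq[of "UNIV :: bool set" "Suc l"]
      by auto
  qed (rule that)
  have gT: "g (x F) \<subseteq> T" for F
  proof (rule g_subset_if_cyl_nonempty)
    fix l
    have "prefix (map (x F) [0..<l]) (S l (map F [0..<l]))"
      using prefix_map_upt[of l "length (S l (map F [0..<l]))" "x F"] Sx(3)[of "map F [0..<l]" l] Sx(4)[of l F] by simp
    moreover have "cyl (S l (map F [0..<l])) \<noteq> {}" using ne Sx(1)[of "map F [0..<l]" l] by simp
    ultimately show "cyl (map (x F) [0..<l]) \<noteq> {}" using cyl_antimono by blast
  qed
  have xcyl: "x F \<in> cyl (S l (map F [0..<l]))" for F l
    using gT[of F] Sx(4)[of l F] by (simp add: cyl_def)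
  have "\<exists>n0. \<forall>n\<ge>n0. \<not> (large (g (x F)) n \<and> large (g (x F')) n)" if FF: "F \<noteq> F'" for F F'
  proof -
    obtain j where j: "F j \<noteq> F' j" using FF by blast
    have neq: "map F [0..<l] \<noteq> map F' [0..<l]" if "l > j" for l using j that by auto
    define N where "N l = min (NS (S l (map F [0..<l]))) (NS (S l (map F' [0..<l])))" for l
    have Nl: "N l \<ge> l" for l
      using NS(1)[OF Sx(1)[of "map F [0..<l]" l]] NS(1)[OF Sx(1)[of "map F' [0..<l]" l]]
        Sx(3)[of "map F [0..<l]" l] Sx(3)[of "map F' [0..<l]" l] by (simp add: N_def)
    have "\<not> (large (g (x F)) n \<and> large (g (x F')) n)" if n: "n \<ge> N (Suc j)" for n
    proof -
      \<comment> \<open>The stage whose interval from \<open>N l\<close> to \<open>N (Suc l)\<close>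
        contains \<open>n\<close>.\<close>
      define l where "l = (LEAST l. j \<le> l \<and> n < N (Suc l))"
      have "j \<le> max j n \<and> n < N (Suc (max j n))" using Nl[of "Suc (max j n)"] by simp
      then have l: "j \<le> l" "n < N (Suc l)" unfolding l_def by (metis (mono_tags, lifting) LeastI)+
      then have "l \<noteq> j" using n by auto
      then obtain l' where l': "l = Suc l'" "j \<le> l'" using l(1) by (cases l) auto
      then have "\<not> n < N (Suc l')" using not_less_Least[of l' "\<lambda>l. j \<le> l \<and> n < N (Suc l)"] by (auto simp: l_def)
      then have Nn: "N l \<le> n" using l' by simp
      have tk: "take l (map F [0..<Suc l]) = map F [0..<l]" for F :: "nat \<Rightarrow> bool" by (simp add: take_map)
      show ?thesis
        using neq[of "Suc l"] l Nn xcyl[of F "Suc l"] xcyl[of F' "Suc l"] tk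
        by (intro covD[OF Sx(2)[of l], of "map F [0..<Suc l]" "map F' [0..<Suc l]"]) (simp_all only: N_def, simp_all)
    qed
    then show ?thesis by blast
  qed
  note disj = this
  obtain K r where K: "finite K" "card K = 2" "r \<in> \<A>" "\<forall>F\<in>K. r \<subseteq> g (x F)"
    using ccc_common_extension[OF ccc_A, of "\<lambda>F. g (x F)" 2] g_in uncountable_nat_bool by blast
  then obtain F F' where FF: "F \<in> K" "F' \<in> K" "F \<noteq> F'" by (auto simp: card_2_iff)
  obtain n0 where n0: "\<And>n. n \<ge> n0 \<Longrightarrow> \<not> (large (g (x F)) n \<and> large (g (x F')) n)" using disj[OF FF(3)] by blast
  have "\<exists>\<^sub>\<infinity>n. large r n" using K FF gT by (intro infinitely_often_large) blast+
  then obtain n where n: "n \<ge> n0" "large r n" by (auto simp: INFM_nat_le)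
  have "large (g (x H)) n" if "H \<in> K" for H
  proof -
    have "card (core r n) \<le> card (core (g (x H)) n)"
      using K(4) that by (intro card_mono core_mono finite_core[OF g_tree]) blast
    then show ?thesis using n(2) by (simp add: large_def)
  qed
  then show False using n0 n(1) FF by blast
qed

text \<open>For almost all \<open>i\<close>, a subtree of \<open>T\<close> has a large level between
  \<open>p i\<close> and \<open>b i\<close>. As \<open>\<psi>\<close> exceeds \<open>D i\<close>
  from \<open>p i\<close> on, monotonicity of core sizes carries the bound to
  \<open>b i\<close>.\<close>

lemma exists_levels:
  fixes D :: "nat \<Rightarrow> real"
  obtains b where "strict_mono b"
    "\<And>U. U \<in> \<A> \<Longrightarrow> U \<subseteq> T \<Longrightarrow> \<forall>\<^sub>\<infinity>i. D i < real (card (core U (b i)))"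
proof -
  obtain k where k: "\<And>x. x \<in> cyl [] \<Longrightarrow> \<forall>\<^sub>\<infinity>n. \<exists>m\<in>{n..k n}. large (g x) m"
    using large_bounded_all unfolding large_bounded_def by blast
  have ex: "\<exists>n\<ge>N. \<forall>m\<ge>n. d < \<psi> m" for N d
  proof -
    obtain n where "\<And>m. m \<ge> n \<Longrightarrow> d < \<psi> m"
      using \<psi>_top by (auto simp: filterlim_at_top_dense eventually_sequentially)
    then show ?thesis by (intro exI[of _ "max n N"]) auto
  qed
  have "\<exists>p. \<forall>i. (i \<le> p i \<and> (\<forall>m\<ge>p i. D i < \<psi> m)) \<and> max (k (p i)) (p i) < p (Suc i)"
  proof (rule dependent_nat_choice)
    show "\<exists>n. 0 \<le> n \<and> (\<forall>m\<ge>n. D 0 < \<psi> m)" using ex by blast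
    show "\<exists>y. (Suc i \<le> y \<and> (\<forall>m\<ge>y. D (Suc i) < \<psi> m)) \<and> max (k n) n < y" for n i
    proof -
      obtain y where "y \<ge> max (Suc i) (Suc (max (k n) n))" "\<forall>m\<ge>y. D (Suc i) < \<psi> m" using ex by blast
      then show ?thesis by (intro exI[of _ y]) auto
    qed
  qed
  then obtain p where p: "\<And>i. i \<le> p i" "\<And>i m. m \<ge> p i \<Longrightarrow> D i < \<psi> m" "\<And>i. max (k (p i)) (p i) < p (Suc i)" by blast
  define b where "b i = max (k (p i)) (p i)" for i
  have "strict_mono b" unfolding strict_mono_Suc_iff b_def using p(3) by (meson less_le_trans max.cobounded2)
  moreover have "\<forall>\<^sub>\<infinity>i. D i < real (card (core U (b i)))" if U: "U \<in> \<A>" "U \<subseteq> T" for U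
  proof -
    obtain x where x: "U = g x" using U(1) range_g by blast
    then have "x \<in> cyl []" using U(2) by (simp add: cyl_def)
    then obtain n0 where n0: "\<And>n. n \<ge> n0 \<Longrightarrow> \<exists>m\<in>{n..k n}. large U m" using k[of x] unfolding x MOST_nat_le by blast
    have "D i < real (card (core U (b i)))" if i: "i \<ge> n0" for i
    proof -
      have "p i \<ge> n0" using p(1)[of i] i by simp
      then obtain m where m: "m \<in> {p i..k (p i)}" "large U m" using n0 by blast
      have "D i < \<psi> m" using m p(2) by simp
      also have "\<psi> m \<le> real (card (core U m))" using m(2) by (simp add: large_def)
      also have "\<dots> \<le> real (card (core U (b i)))"
        using m(1) card_core_mono[OF g_tree[of x], of m "b i"] x by (simp add: b_def)
      finally show ?thesis .
    qed
    then show ?thesis by (auto simp: MOST_nat_le)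
  qed
  ultimately show ?thesis using that by blast
qed

text \<open>The colouring of level \<open>b i\<close> is copied by restriction to all nodes of
  length at least \<open>b i\<close> and below \<open>b (Suc i)\<close>. A homogeneous level in that
  block has homogeneous restrictions to length \<open>b i\<close>, and these contain the
  core.\<close>

lemma core_homogeneous_infinitely_often:
  fixes b :: "nat \<Rightarrow> nat"
  assumes b: "strict_mono b" and T': "T' \<in> \<A>"
  shows "\<exists>S\<in>\<A>. S \<subseteq> T' \<and> (\<exists>\<^sub>\<infinity>i. core S (b i) \<subseteq> c i \<or> core S (b i) \<inter> c i = {})"
proof -
  \<comment> \<open>The block containing \<open>n\<close>. Lengths below \<open>b 0\<close> also get
    index 0; the homogeneous level is later taken beyond them.\<close>
  define ix where "ix n = (LEAST i. n < b (Suc i))" for n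
  have ix1: "n < b (Suc (ix n))" for n unfolding ix_def
    by (rule LeastI[of _ n]) (use seq_suble[OF b, of "Suc n"] in simp)
  have ix2: "b (ix n) \<le> n" if "b 0 \<le> n" for n
  proof (cases "ix n")
    case 0
    then show ?thesis using that by simp
  next
    case (Suc i)
    then have "\<not> n < b (Suc i)" unfolding ix_def by (metis lessI not_less_Least)
    then show ?thesis using Suc by simp
  qed
  have ix3: "j \<le> ix n" if "b j \<le> n" for j n
  proof -
    have "b j < b (Suc (ix n))" using that ix1[of n] by simp
    then show ?thesis using strict_mono_less[OF b] by simp
  qed
  define col :: "nat list \<Rightarrow> nat" where
    "col s = (if take (b (ix (length s))) s \<in> c (ix (length s)) then 1 else 0)" for s
  have "col \<in> seq f \<rightarrow> {0, 1}" by (auto simp: col_def)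
  then obtain S where S: "S \<in> \<A>" "S \<subseteq> T'" "\<exists>\<^sub>\<infinity>n. homogeneous col (level S n)" using bad T' by blast
  have "\<exists>i\<ge>j. core S (b i) \<subseteq> c i \<or> core S (b i) \<inter> c i = {}" for j
  proof -
    obtain n where n: "n \<ge> max (b j) (b 0)" "homogeneous col (level S n)" using S(3) unfolding INFM_nat_le by blast
    define i where "i = ix n"
    have i: "i \<ge> j" "b i \<le> n" using ix2 ix3 n(1) by (auto simp: i_def)
    have sub: "core S (b i) \<subseteq> take (b i) ` level S n" using i(2) by (rule core_subset_take_level)
    obtain v where v: "\<And>s. s \<in> level S n \<Longrightarrow> col s = v" using n(2) by (auto simp: homogeneous_def constant_on_def)
    have "v = (if take (b i) s \<in> c i then 1 else 0)" if "s \<in> level S n" for s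
      using v[OF that] that by (simp add: col_def i_def level_def)
    then have "core S (b i) \<subseteq> c i \<or> core S (b i) \<inter> c i = {}"
      using sub by (cases "v = 1") (force split: if_splits)+
    then show ?thesis using i(1) by blast
  qed
  then show ?thesis using S(1,2) unfolding INFM_nat_le by blast
qed

text \<open>Independent uniformly random colourings of the levels \<open>b i\<close> of \<open>T\<close>. After passing to a
  subsequence, restricting further to a set of levels never changes whether the colourings handled
  by trees from a given cylinder are negligible; therefore a non-negligible cylinder handles a
  non-negligible proportion of the colourings of almost every level, and any four such
  cylinders contain trees with a small common part.\<close>

lemma impossible: False
proof -

  \<comment> \<open>Random colourings of sparse levels\<close>
  define \<delta> :: "nat \<Rightarrow> real" where "\<delta> i = (1/2) ^ Suc i" for i
  \<comment> \<open>The bound of \<open>four_up_families\<close> at density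
    \<open>\<delta> i\<close>. That density is half of the summable \<open>(1/2) ^ i\<close>: a core
    may be homogeneous in either colour, and complementation reduces to one of them.\<close>
  define D where "D i = 2 / (\<delta> i ^ 4)\<^sup>2" for i
  have \<delta>0: "\<delta> i > 0" for i by (simp add: \<delta>_def)
  obtain b where b: "strict_mono b"
    "\<And>U. U \<in> \<A> \<Longrightarrow> U \<subseteq> T \<Longrightarrow> \<forall>\<^sub>\<infinity>i. D i < real (card (core U (b i)))" using exists_levels[of D] by blast
  define V where "V i = level T (b i)" for i
  define \<Omega> where "\<Omega> i = Pow (V i)" for i
  have finV: "finite (V i)" for i unfolding V_def using T_in A_trees by (intro finite_level) auto
  have fin\<Omega>: "finite (\<Omega> i)" "\<Omega> i \<noteq> {}" for i using finV by (auto simp: \<Omega>_def)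
  have card\<Omega>: "real (card (\<Omega> i)) = 2 ^ card (V i)" for i by (simp add: \<Omega>_def card_Pow finV)
  define hom where "hom x y i \<longleftrightarrow> core (g x) (b i) \<subseteq> y \<or> core (g x) (b i) \<inter> y = {}" for x y i
  \<comment> \<open>Coordinates outside the range of \<open>r\<close> stay free, so negligibility
    along different subsequences is measured in the same product.\<close>
  define pi where "pi r X = {c. (\<forall>i. c i \<in> \<Omega> i) \<and> (\<exists>x\<in>X. \<exists>\<^sub>\<infinity>i. hom x (c (r i)) (r i))}"
    for r :: "nat \<Rightarrow> nat" and X
  have pi_mono: "pi r X \<subseteq> pi r Y" if "X \<subseteq> Y" for r X Y using that by (auto simp: pi_def)
  have pi_sub: "pi (r \<circ> r') X \<subseteq> pi r X" if "strict_mono r'" for r r' X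
  proof
    fix c assume "c \<in> pi (r \<circ> r') X"
    then obtain x where x: "\<forall>i. c i \<in> \<Omega> i" "x \<in> X" "\<exists>\<^sub>\<infinity>i. hom x (c (r (r' i))) (r (r' i))" by (auto simp: pi_def)
    show "c \<in> pi r X" using x(1,2) INFM_subseq[OF that, of "\<lambda>i. hom x (c (r i)) (r i)"] x(3) by (auto simp: pi_def)
  qed
  have pi_shift: "pi r X \<subseteq> pi (r \<circ> (+) k) X" for r X k
  proof
    fix c assume "c \<in> pi r X"
    then obtain x where x: "\<forall>i. c i \<in> \<Omega> i" "x \<in> X" "\<exists>\<^sub>\<infinity>i. hom x (c (r i)) (r i)" by (auto simp: pi_def)
    show "c \<in> pi (r \<circ> (+) k) X" using x(1,2) INFM_shift[OF x(3), of k] by (auto simp: pi_def)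
  qed
  have pi_all: "pi r (cyl []) = {c. \<forall>i. c i \<in> \<Omega> i}" if r: "strict_mono r" for r
  proof -
    have "\<exists>x\<in>cyl []. \<exists>\<^sub>\<infinity>i. hom x (c (r i)) (r i)" for c
    proof -
      have "strict_mono (b \<circ> r)" using b(1) r by (rule strict_mono_o)
      then obtain S where S: "S \<in> \<A>" "S \<subseteq> T" "\<exists>\<^sub>\<infinity>i. core S ((b \<circ> r) i) \<subseteq> c (r i) \<or> core S ((b \<circ> r) i) \<inter> c (r i) = {}"
        using core_homogeneous_infinitely_often[OF _ T_in, of "b \<circ> r" "\<lambda>i. c (r i)"] by blast
      obtain x where "S = g x" using S(1) range_g by blast
      then show ?thesis using S by (intro bexI[of _ x]) (auto simp: cyl_def hom_def)
    qed
    then show ?thesis by (auto simp: pi_def)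
  qed
  define null where "null = limsup_null \<Omega>"
  have null_sub: "null X" if "null Y" "X \<subseteq> Y" for X Y using that limsup_null_subset unfolding null_def by blast

  \<comment> \<open>Stabilising negligibility along subsequences\<close>
  define Pd where "Pd n r \<longleftrightarrow> null (pi r (cyl (from_nat n))) \<or>
      (\<forall>r'. strict_mono r' \<longrightarrow> \<not> null (pi (r \<circ> r') (cyl (from_nat n))))" for n :: nat and r :: "nat \<Rightarrow> nat"
  interpret Pd: subseqs Pd
  proof
    fix n and s :: "nat \<Rightarrow> nat"
    show "\<exists>r'. strict_mono r' \<and> Pd n (s \<circ> r')"
    proof (cases "\<exists>r'. strict_mono r' \<and> null (pi (s \<circ> r') (cyl (from_nat n)))")
      case True
      then show ?thesis by (auto simp: Pd_def)
    next
      case False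
      then have "Pd n (s \<circ> id)" by (auto simp: Pd_def)
      then show ?thesis using strict_mono_id by blast
    qed
  qed
  define r where "r = Pd.diagseq"
  have r: "strict_mono r" unfolding r_def by (rule Pd.subseq_diagseq)
  have dich: "null (pi r (cyl s)) \<or> (\<forall>r'. strict_mono r' \<longrightarrow> \<not> null (pi (r \<circ> r') (cyl s)))" for s
  proof -
    define n where "n = to_nat s"
    have s: "from_nat n = s" by (simp add: n_def)
    \<comment> \<open>Only from position \<open>Suc n\<close> on does the diagonal sequence run
      inside the refinement made for \<open>n\<close>; shifts transfer both alternatives from this
      tail to \<open>r\<close>.\<close>
    have "Pd n (r \<circ> (+) (Suc n))" unfolding r_def
    proof (rule Pd.diagseq_holds)
      fix r' r'' :: "nat \<Rightarrow> nat" and m assume sm: "strict_mono r'" and P: "Pd m r''"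
      show "Pd m (r'' \<circ> r')"
      proof (cases "null (pi r'' (cyl (from_nat m)))")
        case True
        then have "null (pi (r'' \<circ> r') (cyl (from_nat m)))" using null_sub pi_sub[OF sm] by blast
        then show ?thesis by (simp add: Pd_def)
      next
        case False
        then have "\<not> null (pi (r'' \<circ> q) (cyl (from_nat m)))" if "strict_mono q" for q using P that by (simp add: Pd_def)
        then have "\<not> null (pi ((r'' \<circ> r') \<circ> q) (cyl (from_nat m)))" if "strict_mono q" for q
          using strict_mono_o[OF sm that] by (simp add: comp_assoc)
        then show ?thesis by (simp add: Pd_def)
      qed
    qed
    then consider "null (pi (r \<circ> (+) (Suc n)) (cyl s))" |
        "\<And>r'. strict_mono r' \<Longrightarrow> \<not> null (pi (r \<circ> (+) (Suc n) \<circ> r') (cyl s))" by (auto simp: Pd_def s)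
    then show ?thesis
    proof cases
      case 1
      then show ?thesis using null_sub pi_shift by blast
    next
      case 2
      have "\<not> null (pi (r \<circ> r') (cyl s))" if r': "strict_mono r'" for r'
      proof
        assume nu: "null (pi (r \<circ> r') (cyl s))"
        \<comment> \<open>Shifting \<open>r'\<close> exhibits a tail of \<open>r \<circ> r'\<close>
          as a subsequence of the tail of \<open>r\<close>, to which the second alternative
          applies.\<close>
        define q where "q i = r' (Suc n + i) - Suc n" for i
        have ge: "Suc n + i \<le> r' (Suc n + i)" for i using seq_suble[OF r'] .
        have "strict_mono q" unfolding strict_mono_Suc_iff q_def
        proof
          fix i show "r' (Suc n + i) - Suc n < r' (Suc n + Suc i) - Suc n"
            using ge[of i] ge[of "Suc i"] strict_monoD[OF r', of "Suc n + i" "Suc n + Suc i"] by linarith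
        qed
        moreover have "r \<circ> (+) (Suc n) \<circ> q = (r \<circ> r') \<circ> (+) (Suc n)"
        proof
          fix i show "(r \<circ> (+) (Suc n) \<circ> q) i = ((r \<circ> r') \<circ> (+) (Suc n)) i" using ge[of i] by (simp add: q_def)
        qed
        moreover have "strict_mono ((+) (Suc n) :: nat \<Rightarrow> nat)" by (auto simp: strict_mono_def)
        ultimately have "\<not> null (pi ((r \<circ> r') \<circ> (+) (Suc n)) (cyl s))" using 2 by metis
        moreover have "pi ((r \<circ> r') \<circ> (+) (Suc n)) (cyl s) \<subseteq> pi (r \<circ> r') (cyl s)"
          by (rule pi_sub) (auto simp: strict_mono_def)
        ultimately show False using nu null_sub by blast
      qed
      then show ?thesis by blast
    qed
  qed

  \<comment> \<open>Kernels of non-negligible cylinders\<close>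
  define G where "G = {s. \<not> null (pi r (cyl s))}"
  define ker where "ker s = {x \<in> cyl s. \<forall>l. map x [0..<l] \<in> G}" for s
  have Nil: "[] \<in> G"
    using not_limsup_null_all[of \<Omega>] fin\<Omega> pi_all[OF r] by (simp add: G_def null_def)
  have ker_pos: "\<not> null (pi (r \<circ> r') (ker s))" if s: "s \<in> G" and r': "strict_mono r'" for s r'
    unfolding ker_def
  proof (rule kernel_positive[where I = "\<lambda>X. null (pi (r \<circ> r') X)"])
    show "null (pi (r \<circ> r') X)" if "null (pi (r \<circ> r') Y)" "X \<subseteq> Y" for X Y
      using null_sub[OF that(1) pi_mono[OF that(2)]] .
    show "null (pi (r \<circ> r') (\<Union>s\<in>J. F s))" if "\<And>s. s \<in> J \<Longrightarrow> null (pi (r \<circ> r') (F s))"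
      for J and F :: "nat list \<Rightarrow> (nat \<Rightarrow> nat) set"
    proof -
      have "pi (r \<circ> r') (\<Union>s\<in>J. F s) = (\<Union>s\<in>J. pi (r \<circ> r') (F s))" by (auto simp: pi_def)
      then show ?thesis using that fin\<Omega>(1) unfolding null_def by (simp add: limsup_null_countable_UN)
    qed
    show "null (pi (r \<circ> r') (cyl s))" if "s \<notin> G" for s
      using that null_sub pi_sub[OF r'] by (auto simp: G_def)
    show "\<not> null (pi (r \<circ> r') (cyl s))" using dich[of s] s r' by (auto simp: G_def)
  qed
  have ker_ne: "ker s \<noteq> {}" if "s \<in> G" for s
  proof
    assume "ker s = {}"
    then have "pi (r \<circ> id) (ker s) = {}" by (simp add: pi_def)
    moreover have "null {}" by (auto simp: null_def limsup_null_def intro!: exI[of _ "\<lambda>_. {}"])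
    ultimately show False using ker_pos[OF that strict_mono_id] by simp
  qed
  define Pc where "Pc i s = {y \<in> \<Omega> i. \<exists>x\<in>ker s. hom x y i}" for i s
  define Up where "Up i s = {y \<in> \<Omega> i. \<exists>x\<in>ker s. core (g x) (b i) \<subseteq> y}" for i s
  \<comment> \<open>Otherwise some subsequence \<open>r \<circ> r'\<close> has proportions at most
    \<open>(1/2) ^ i\<close>. These are summable, so the colourings handled along it by the kernel
    would be negligible, against \<open>ker_pos\<close>.\<close>
  have dense: "\<forall>\<^sub>\<infinity>j. real (card (Pc (r j) s)) > (1/2) ^ r j * 2 ^ card (V (r j))" if s: "s \<in> G" for s
  proof (rule ccontr)
    assume "\<not> ?thesis"
    then have "infinite {j. real (card (Pc (r j) s)) \<le> (1/2) ^ r j * 2 ^ card (V (r j))}"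
      by (simp add: frequently_cofinite not_eventually not_less)
    from infinite_enumerate[OF this] obtain r' :: "nat \<Rightarrow> nat" where r': "strict_mono r'"
      "\<And>j. real (card (Pc (r (r' j)) s)) \<le> (1/2) ^ r (r' j) * 2 ^ card (V (r (r' j)))"
      unfolding mem_Collect_eq by blast
    define Y where "Y i = (if i \<in> range (r \<circ> r') then Pc i s else {})" for i
    have le: "real (card (Y i)) / real (card (\<Omega> i)) \<le> (1/2) ^ i" for i
      using r'(2) by (auto simp: Y_def card\<Omega> divide_le_eq)
    have "summable (\<lambda>i. real (card (Y i)) / real (card (\<Omega> i)))"
      by (rule summable_comparison_test'[of "\<lambda>i. (1/2) ^ i" 0]) (use le in \<open>auto simp: summable_geometric\<close>)
    moreover have "\<exists>\<^sub>\<infinity>i. c i \<in> Y i" if c: "c \<in> pi (r \<circ> r') (ker s)" for c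
    proof -
      obtain x where x: "\<forall>i. c i \<in> \<Omega> i" "x \<in> ker s" "\<exists>\<^sub>\<infinity>j. hom x (c (r (r' j))) (r (r' j))"
        using c by (auto simp: pi_def)
      have "\<exists>\<^sub>\<infinity>j. c ((r \<circ> r') j) \<in> Y ((r \<circ> r') j)"
        using x(3) by (rule INFM_mono) (use x(1,2) in \<open>auto simp: Y_def Pc_def\<close>)
      then show ?thesis using INFM_subseq[OF strict_mono_o[OF r r'(1)], of "\<lambda>i. c i \<in> Y i"] by blast
    qed
    moreover have "Y i \<subseteq> \<Omega> i" for i by (auto simp: Y_def Pc_def)
    ultimately have "null (pi (r \<circ> r') (ker s))" unfolding null_def limsup_null_def by blast
    then show False using ker_pos[OF s r'(1)] by simp
  qed
  have core_V: "core (g x) (b i) \<subseteq> V i" if "x \<in> ker s" for x s i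
    using that core_subset_level[of "g x" "b i"] by (auto simp: ker_def cyl_def V_def level_def)
  have Up_family: "up_family (V i) (Up i s)" for i s by (auto simp: up_family_def Up_def \<Omega>_def)
  have finUp: "finite (Up i s)" for i s using fin\<Omega>(1)[of i] by (simp add: Up_def)
  have Up_card: "\<delta> i * 2 ^ card (V i) \<le> real (card (Up i s))"
    if "real (card (Pc i s)) > (1/2) ^ i * 2 ^ card (V i)" for i s
  proof -
    have "Pc i s \<subseteq> Up i s \<union> (\<lambda>y. V i - y) ` Up i s"
    proof
      fix y assume "y \<in> Pc i s"
      then obtain x where x: "y \<subseteq> V i" "x \<in> ker s" "hom x y i" by (auto simp: Pc_def \<Omega>_def)
      show "y \<in> Up i s \<union> (\<lambda>y. V i - y) ` Up i s"
      proof (cases "core (g x) (b i) \<subseteq> y")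
        case True
        then show ?thesis using x by (auto simp: Up_def \<Omega>_def)
      next
        case False
        then have "core (g x) (b i) \<subseteq> V i - y" using x(3) core_V[OF x(2)] by (auto simp: hom_def)
        then have "V i - y \<in> Up i s" using x by (auto simp: Up_def \<Omega>_def)
        moreover have "y = V i - (V i - y)" using x(1) by auto
        ultimately show ?thesis by blast
      qed
    qed
    then have "card (Pc i s) \<le> card (Up i s \<union> (\<lambda>y. V i - y) ` Up i s)" using finUp by (intro card_mono) auto
    also have "\<dots> \<le> card (Up i s) + card ((\<lambda>y. V i - y) ` Up i s)" by (rule card_Un_le)
    also have "\<dots> \<le> 2 * card (Up i s)" using card_image_le[OF finUp[of i s], of "\<lambda>y. V i - y"] by simp
    finally have "real (card (Pc i s)) \<le> 2 * real (card (Up i s))" by linarith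
    with that show ?thesis by (simp add: \<delta>_def)
  qed

  \<comment> \<open>A Cantor scheme with small fourfold intersections\<close>
  define Req where "Req l K S \<longleftrightarrow> (\<exists>i\<ge>l. \<forall>z. (\<forall>\<sigma>\<in>K. z \<sigma> \<in> cyl (S \<sigma>)) \<longrightarrow>
      real (card (\<Inter>\<sigma>\<in>K. core (g (z \<sigma>)) (b i))) \<le> D i)"
    for l :: nat and K :: "bool list set" and S :: "bool list \<Rightarrow> nat list"
  \<comment> \<open>The bound concerns all points of the cylinders and not just the witnesses, so
    later extensions cannot destroy it.\<close>
  have Req_ext: "Req l K S'" if R: "Req l K S" and ext: "\<And>\<sigma>. \<sigma> \<in> K \<Longrightarrow> prefix (S \<sigma>) (S' \<sigma>)" for l K S S'
  proof -
    obtain i where i: "i \<ge> l" "\<And>z. (\<forall>\<sigma>\<in>K. z \<sigma> \<in> cyl (S \<sigma>)) \<Longrightarrow> real (card (\<Inter>\<sigma>\<in>K. core (g (z \<sigma>)) (b i))) \<le> D i"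
      using R unfolding Req_def by blast
    have "real (card (\<Inter>\<sigma>\<in>K. core (g (z \<sigma>)) (b i))) \<le> D i" if z: "\<forall>\<sigma>\<in>K. z \<sigma> \<in> cyl (S' \<sigma>)" for z
      using z cyl_antimono[OF ext] by (intro i(2)) blast
    then show ?thesis unfolding Req_def using i(1) by blast
  qed
  have Req_ex: "\<exists>S'. (\<forall>\<sigma>\<in>K. S' \<sigma> \<in> G \<and> prefix (S \<sigma>) (S' \<sigma>)) \<and> Req l K S'"
    if S: "\<And>\<sigma>. \<sigma> \<in> K \<Longrightarrow> S \<sigma> \<in> G" and K: "card K = 4" for l K S
  proof -
    have finK: "finite K" "K \<noteq> {}" using K by (auto intro: card_ge_0_finite)
    have "\<forall>\<^sub>\<infinity>j. \<forall>\<sigma>\<in>K. real (card (Pc (r j) (S \<sigma>))) > (1/2) ^ r j * 2 ^ card (V (r j))"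
      unfolding cofinite_eq_sequentially using dense[OF S] finK(1)
      by (intro eventually_ball_finite) (auto simp: cofinite_eq_sequentially)
    then obtain j0 where j0: "\<And>j \<sigma>. j \<ge> j0 \<Longrightarrow> \<sigma> \<in> K \<Longrightarrow> real (card (Pc (r j) (S \<sigma>))) > (1/2) ^ r j * 2 ^ card (V (r j))"
      unfolding MOST_nat_le by blast
    define i where "i = r (max j0 l)"
    have il: "i \<ge> l" using seq_suble[OF r, of "max j0 l"] by (simp add: i_def)
    have dens: "\<delta> i * 2 ^ card (V i) \<le> real (card (Up i (S \<sigma>)))" if "\<sigma> \<in> K" for \<sigma>
      using j0[of "max j0 l" \<sigma>] that by (intro Up_card) (simp add: i_def)
    have "\<exists>y. (\<forall>\<sigma>\<in>K. y \<sigma> \<in> Up i (S \<sigma>)) \<and> real (card (\<Inter>\<sigma>\<in>K. y \<sigma>)) \<le> D i"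
    proof (rule four_up_families[of "V i" K "\<lambda>\<sigma>. Up i (S \<sigma>)" "\<delta> i", OF finV Up_family K \<delta>0 dens])
      fix y assume "\<And>\<sigma>. \<sigma> \<in> K \<Longrightarrow> y \<sigma> \<in> Up i (S \<sigma>)" "real (card (\<Inter>\<sigma>\<in>K. y \<sigma>)) \<le> 2 / (\<delta> i ^ 4)\<^sup>2"
      then show "\<exists>y. (\<forall>\<sigma>\<in>K. y \<sigma> \<in> Up i (S \<sigma>)) \<and> real (card (\<Inter>\<sigma>\<in>K. y \<sigma>)) \<le> D i"
        unfolding D_def by blast
    qed
    then obtain y where y: "\<And>\<sigma>. \<sigma> \<in> K \<Longrightarrow> y \<sigma> \<in> Up i (S \<sigma>)" "real (card (\<Inter>\<sigma>\<in>K. y \<sigma>)) \<le> D i"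
      by blast
    have "\<forall>\<sigma>\<in>K. \<exists>x. x \<in> ker (S \<sigma>) \<and> core (g x) (b i) \<subseteq> y \<sigma>" using y(1) by (auto simp: Up_def)
    then obtain x where x: "\<And>\<sigma>. \<sigma> \<in> K \<Longrightarrow> x \<sigma> \<in> ker (S \<sigma>)" "\<And>\<sigma>. \<sigma> \<in> K \<Longrightarrow> core (g (x \<sigma>)) (b i) \<subseteq> y \<sigma>" by metis
    \<comment> \<open>Cylinders around the kernel points \<open>x \<sigma>\<close> are shrunk until
      all their cores at \<open>b i\<close> lie inside \<open>y \<sigma>\<close>.\<close>
    have "\<forall>\<^sub>F l in sequentially. \<forall>\<sigma>\<in>K. length (S \<sigma>) \<le> l \<and>
        (\<forall>x'\<in>cyl (map (x \<sigma>) [0..<l]). \<forall>n\<le>b i. core (g x') n \<subseteq> core (g (x \<sigma>)) n)"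
      using finK(1) by (intro eventually_ball_finite ballI eventually_conj core_locally_decreasing eventually_ge_at_top)
    then obtain l1 where l1: "\<And>\<sigma>. \<sigma> \<in> K \<Longrightarrow> length (S \<sigma>) \<le> l1"
      "\<And>\<sigma> x'. \<sigma> \<in> K \<Longrightarrow> x' \<in> cyl (map (x \<sigma>) [0..<l1]) \<Longrightarrow> core (g x') (b i) \<subseteq> core (g (x \<sigma>)) (b i)"
      unfolding eventually_sequentially by blast
    define S' where "S' \<sigma> = map (x \<sigma>) [0..<l1]" for \<sigma>
    have "S' \<sigma> \<in> G \<and> prefix (S \<sigma>) (S' \<sigma>)" if "\<sigma> \<in> K" for \<sigma>
      using x(1)[OF that] prefix_map_upt[OF l1(1)[OF that], of "x \<sigma>"] by (auto simp: ker_def S'_def cyl_def)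
    moreover have "real (card (\<Inter>\<sigma>\<in>K. core (g (z \<sigma>)) (b i))) \<le> D i" if z: "\<forall>\<sigma>\<in>K. z \<sigma> \<in> cyl (S' \<sigma>)" for z
    proof -
      have sub: "core (g (z \<sigma>)) (b i) \<subseteq> y \<sigma>" if "\<sigma> \<in> K" for \<sigma>
        using l1(2)[OF that, of "z \<sigma>"] x(2)[OF that] z that by (auto simp: S'_def)
      obtain \<sigma>0 where \<sigma>0: "\<sigma>0 \<in> K" using finK by blast
      have "y \<sigma>0 \<subseteq> V i" using y(1)[OF \<sigma>0] by (auto simp: Up_def \<Omega>_def)
      then have "finite (y \<sigma>0)" using finV finite_subset by blast
      then have "finite (\<Inter>\<sigma>\<in>K. y \<sigma>)" using \<sigma>0 by (intro finite_INT) blast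
      then have "card (\<Inter>\<sigma>\<in>K. core (g (z \<sigma>)) (b i)) \<le> card (\<Inter>\<sigma>\<in>K. y \<sigma>)"
        using sub by (intro card_mono INT_anti_mono) auto
      then show ?thesis using y(2) by linarith
    qed
    ultimately show ?thesis unfolding Req_def using il by blast
  qed
  have round: "\<exists>S'. (\<forall>\<sigma>\<in>\<Sigma>. S' \<sigma> \<in> G \<and> prefix (S \<sigma>) (S' \<sigma>) \<and> l < length (S' \<sigma>)) \<and>
      (\<forall>K. K \<subseteq> \<Sigma> \<and> card K = 4 \<longrightarrow> Req l K S')"
    if fin: "finite \<Sigma>" and S: "\<And>\<sigma>. \<sigma> \<in> \<Sigma> \<Longrightarrow> S \<sigma> \<in> G" for \<Sigma> S l
  proof -
    define \<K> where "\<K> = {K. K \<subseteq> \<Sigma> \<and> card K = 4}"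
    have "\<exists>S'. (\<forall>\<sigma>\<in>\<Sigma>. S' \<sigma> \<in> G \<and> prefix (S \<sigma>) (S' \<sigma>) \<and> l < length (S' \<sigma>)) \<and> (\<forall>K\<in>\<K>'. Req l K S')"
      if "\<K>' \<subseteq> \<K>" for \<K>'
    proof -
      have "finite \<K>'" using that fin by (auto simp: \<K>_def intro: finite_subset[of _ "Pow \<Sigma>"])
      then show ?thesis using that
      proof (induction \<K>' rule: finite_induct)
        case empty
        have "\<forall>\<sigma>\<in>\<Sigma>. \<exists>x. x \<in> ker (S \<sigma>)" using ker_ne S by blast
        then obtain x where x: "\<And>\<sigma>. \<sigma> \<in> \<Sigma> \<Longrightarrow> x \<sigma> \<in> ker (S \<sigma>)" by metis
        define S' where "S' \<sigma> = map (x \<sigma>) [0..<max (Suc l) (length (S \<sigma>))]" for \<sigma>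
        have "S' \<sigma> \<in> G \<and> prefix (S \<sigma>) (S' \<sigma>) \<and> l < length (S' \<sigma>)" if "\<sigma> \<in> \<Sigma>" for \<sigma>
          using x[OF that] prefix_map_upt[of "length (S \<sigma>)" "max (Suc l) (length (S \<sigma>))" "x \<sigma>"]
          by (auto simp: S'_def ker_def cyl_def)
        then show ?case by blast
      next
        case (insert K \<K>')
        then obtain S1 where S1: "\<And>\<sigma>. \<sigma> \<in> \<Sigma> \<Longrightarrow> S1 \<sigma> \<in> G \<and> prefix (S \<sigma>) (S1 \<sigma>) \<and> l < length (S1 \<sigma>)"
          "\<And>K. K \<in> \<K>' \<Longrightarrow> Req l K S1" by blast
        have K: "K \<subseteq> \<Sigma>" "card K = 4" and \<K>': "\<And>K'. K' \<in> \<K>' \<Longrightarrow> K' \<subseteq> \<Sigma>" using insert.prems by (auto simp: \<K>_def)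
        obtain S' where S': "\<And>\<sigma>. \<sigma> \<in> K \<Longrightarrow> S' \<sigma> \<in> G \<and> prefix (S1 \<sigma>) (S' \<sigma>)" "Req l K S'"
          using Req_ex[of K S1 l] S1(1) K by blast
        define S2 where "S2 \<sigma> = (if \<sigma> \<in> K then S' \<sigma> else S1 \<sigma>)" for \<sigma>
        have pre: "prefix (S1 \<sigma>) (S2 \<sigma>)" for \<sigma> using S'(1) by (auto simp: S2_def)
        have "Req l K S2" by (rule Req_ext[OF S'(2)]) (simp add: S2_def)
        moreover have "Req l K' S2" if "K' \<in> \<K>'" for K' by (rule Req_ext[OF S1(2)[OF that] pre])
        moreover have "S2 \<sigma> \<in> G \<and> prefix (S \<sigma>) (S2 \<sigma>) \<and> l < length (S2 \<sigma>)" if "\<sigma> \<in> \<Sigma>" for \<sigma>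
          using S1(1)[OF that] S'(1)[of \<sigma>] pre[of \<sigma>] prefix_length_le[OF pre[of \<sigma>]] prefix_order.trans[of "S \<sigma>" "S1 \<sigma>" "S2 \<sigma>"]
          by (auto simp: S2_def)
        ultimately show ?case by (intro exI[of _ S2]) blast
      qed
    qed
    from this[OF order_refl] show ?thesis by (auto simp: \<K>_def)
  qed
  obtain S x where Sx: "\<And>l \<sigma>. length \<sigma> = l \<Longrightarrow> S l \<sigma> \<in> G"
    "\<And>l. \<forall>K. K \<subseteq> {\<sigma>. length \<sigma> = Suc l} \<and> card K = 4 \<longrightarrow> Req l K (S (Suc l))"
    "\<And>l \<sigma>. length \<sigma> = l \<Longrightarrow> l \<le> length (S l \<sigma>)"
    "\<And>F l. S l (map F [0..<l]) = map (x F) [0..<length (S l (map F [0..<l]))]"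
  proof (rule cantor_scheme[OF Nil, where R = "\<lambda>l S S'. \<forall>K. K \<subseteq> {\<sigma>. length \<sigma> = Suc l} \<and> card K = 4 \<longrightarrow> Req l K S'"])
    fix l and S :: "bool list \<Rightarrow> nat list"
    assume "\<And>\<sigma>. length \<sigma> = l \<Longrightarrow> S \<sigma> \<in> G"
    then show "\<exists>S'. (\<forall>\<sigma>. length \<sigma> = Suc l \<longrightarrow> S' \<sigma> \<in> G \<and> prefix (S (take l \<sigma>)) (S' \<sigma>) \<and> l < length (S' \<sigma>)) \<and>
        (\<forall>K. K \<subseteq> {\<sigma>. length \<sigma> = Suc l} \<and> card K = 4 \<longrightarrow> Req l K S')"
      using round[of "{\<sigma>. length \<sigma> = Suc l}" "\<lambda>\<sigma>. S (take l \<sigma>)" l] finite_lists_length_eq[of "UNIV :: bool set" "Suc l"]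
      by auto
  qed (rule that)
  have cyl_ne: "cyl s \<noteq> {}" if "s \<in> G" for s using ker_ne[OF that] by (auto simp: ker_def)
  have gT: "g (x F) \<subseteq> T" for F
  proof (rule g_subset_if_cyl_nonempty)
    fix l
    have "prefix (map (x F) [0..<l]) (S l (map F [0..<l]))"
      using prefix_map_upt[of l "length (S l (map F [0..<l]))" "x F"] Sx(3)[of "map F [0..<l]" l] Sx(4)[of l F] by simp
    moreover have "cyl (S l (map F [0..<l])) \<noteq> {}" using cyl_ne Sx(1)[of "map F [0..<l]" l] by simp
    ultimately show "cyl (map (x F) [0..<l]) \<noteq> {}" using cyl_antimono by blast
  qed
  have xcyl: "x F \<in> cyl (S l (map F [0..<l]))" for F l
    using gT[of F] Sx(4)[of l F] by (simp add: cyl_def)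

  \<comment> \<open>Contradiction with the chain condition\<close>
  obtain K U where K: "finite K" "card K = 4" "U \<in> \<A>" "\<And>F. F \<in> K \<Longrightarrow> U \<subseteq> g (x F)"
    using ccc_common_extension[of \<A> "\<lambda>F. g (x F)" 4, OF ccc_A g_in uncountable_nat_bool] by auto
  have K_ne: "K \<noteq> {}" using K(2) by auto
  have "\<forall>\<^sub>F l in sequentially. F \<noteq> F' \<longrightarrow> map F [0..<l] \<noteq> map F' [0..<l]" for F F' :: "nat \<Rightarrow> bool"
  proof (cases "F = F'")
    case False
    then obtain j where "F j \<noteq> F' j" by blast
    then have "map F [0..<l] \<noteq> map F' [0..<l]" if "l \<ge> Suc j" for l using that by auto
    then show ?thesis by (auto simp: eventually_sequentially)
  qed simp
  then have "\<forall>\<^sub>F l in sequentially. \<forall>F\<in>K. \<forall>F'\<in>K. F \<noteq> F' \<longrightarrow> map F [0..<l] \<noteq> map F' [0..<l]"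
    using K(1) by (intro eventually_ball_finite ballI)
  then obtain l0 where l0: "\<And>l. l \<ge> l0 \<Longrightarrow> inj_on (\<lambda>F. map F [0..<l]) K"
    unfolding eventually_sequentially inj_on_def by blast
  \<comment> \<open>Once the four branches have separated, the requirement of each stage applies to
    them, and the core of \<open>U\<close> lies in all four cores.\<close>
  have small: "\<exists>i\<ge>m. real (card (core U (b i))) \<le> D i" for m
  proof -
    define l where "l = max m l0"
    let ?e = "\<lambda>F :: nat \<Rightarrow> bool. map F [0..<Suc l]"
    have inj: "inj_on ?e K" using l0[of "Suc l"] by (simp add: l_def)
    have "card (?e ` K) = 4" using card_image[OF inj] K(2) by simp
    moreover have "?e ` K \<subseteq> {\<sigma>. length \<sigma> = Suc l}" by auto
    ultimately have "Req l (?e ` K) (S (Suc l))" using Sx(2) by blast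
    then obtain i where i: "i \<ge> l" "\<And>z. (\<forall>\<sigma>\<in>?e ` K. z \<sigma> \<in> cyl (S (Suc l) \<sigma>)) \<Longrightarrow>
        real (card (\<Inter>\<sigma>\<in>?e ` K. core (g (z \<sigma>)) (b i))) \<le> D i" unfolding Req_def by blast
    define z where "z \<sigma> = x (inv_into K ?e \<sigma>)" for \<sigma>
    have z: "z (?e F) = x F" if "F \<in> K" for F using inv_into_f_f[OF inj that] by (simp add: z_def)
    have "\<forall>\<sigma>\<in>?e ` K. z \<sigma> \<in> cyl (S (Suc l) \<sigma>)"
    proof
      fix \<sigma> assume "\<sigma> \<in> ?e ` K"
      then obtain F where F: "F \<in> K" "\<sigma> = ?e F" by blast
      show "z \<sigma> \<in> cyl (S (Suc l) \<sigma>)" unfolding F(2) z[OF F(1)] by (rule xcyl)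
    qed
    then have le: "real (card (\<Inter>\<sigma>\<in>?e ` K. core (g (z \<sigma>)) (b i))) \<le> D i" by (rule i(2))
    have eq: "(\<Inter>\<sigma>\<in>?e ` K. core (g (z \<sigma>)) (b i)) = (\<Inter>F\<in>K. core (g (x F)) (b i))"
      unfolding image_image by (intro INF_cong refl) (simp only: z)
    have "card (core U (b i)) \<le> card (\<Inter>F\<in>K. core (g (x F)) (b i))"
    proof (rule card_mono)
      obtain F0 where "F0 \<in> K" using K_ne by blast
      then show "finite (\<Inter>F\<in>K. core (g (x F)) (b i))" using finite_core[OF g_tree] by (intro finite_INT) blast
      show "core U (b i) \<subseteq> (\<Inter>F\<in>K. core (g (x F)) (b i))" using core_mono K(4) by blast
    qed
    then have "real (card (core U (b i))) \<le> D i" using le unfolding eq by linarith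
    then show ?thesis using i(1) by (intro exI[of _ i]) (auto simp: l_def)
  qed
  obtain F0 where "F0 \<in> K" using K_ne by blast
  then have "U \<subseteq> T" using K(4) gT by blast
  then obtain m where m: "\<And>i. i \<ge> m \<Longrightarrow> D i < real (card (core U (b i)))"
    using b(2)[OF K(3)] unfolding MOST_nat_le by blast
  obtain i where "i \<ge> m" "real (card (core U (b i))) \<le> D i" using small by blast
  then show False using m[of i] by linarith
qed

end

subsection \<open>Continuous parametrisations and the theorem\<close>

lemma open_fun_nat_cylinder:
  fixes U :: "(nat \<Rightarrow> nat) set"
  assumes "open U" "x \<in> U"
  shows "\<exists>l. \<forall>x'. (\<forall>j<l. x' j = x j) \<longrightarrow> x' \<in> U"
proof -
  have "openin (product_topology (\<lambda>_. euclidean) UNIV) U"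
    using assms(1) by (simp add: euclidean_product_topology)
  then obtain X where X: "x \<in> (\<Pi>\<^sub>E i\<in>UNIV. X i)" "finite {i. X i \<noteq> UNIV}" "(\<Pi>\<^sub>E i\<in>UNIV. X i) \<subseteq> U"
    using product_topology_open_contains_basis[of "\<lambda>_. euclidean" UNIV U x] assms(2) by auto
  obtain l where l: "\<And>i. X i \<noteq> UNIV \<Longrightarrow> i < l" using X(2) by (auto simp: finite_nat_set_iff_bounded)
  have "x' \<in> U" if "\<forall>j<l. x' j = x j" for x'
  proof -
    have "x' i \<in> X i" for i using l[of i] that X(1) by (cases "X i = UNIV") (auto simp: PiE_iff)
    then show ?thesis using X(3) by auto
  qed
  then show ?thesis by blast
qed

text \<open>Membership of one node is a clopen condition, decided near \<open>x\<close> by finitely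
  many coordinates; a level of \<open>seq f\<close> is finite, so a maximum serves all its
  nodes.\<close>

lemma level_locally_constant_of_continuous:
  fixes g :: "(nat \<Rightarrow> nat) \<Rightarrow> nat list set"
  assumes g: "continuous_map euclidean (tree_topology f) g"
  shows "\<exists>l. \<forall>x'. (\<forall>j<l. x' j = x j) \<longrightarrow> level (g x') L = level (g x) L"
proof -
  have gt: "g x \<in> trees f" for x
    using continuous_map_image_subset_topspace[OF g] by (auto simp: topspace_tree_topology)
  have "\<exists>l. \<forall>x'. (\<forall>j<l. x' j = x j) \<longrightarrow> (s \<in> g x') = (s \<in> g x)" if s: "s \<in> seq f" for s
  proof -
    have "continuous_map (tree_topology f) (discrete_topology (UNIV :: bool set))
        ((\<lambda>h. h s) \<circ> (\<lambda>T. restrict (\<lambda>s. s \<in> T) (seq f)))"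
      unfolding tree_topology_def
      by (rule continuous_map_pullback[OF continuous_map_product_projection[OF s]])
    then have "continuous_map euclidean (discrete_topology UNIV)
        (((\<lambda>h. h s) \<circ> (\<lambda>T. restrict (\<lambda>s. s \<in> T) (seq f))) \<circ> g)"
      by (rule continuous_map_compose[OF g])
    moreover have "((\<lambda>h. h s) \<circ> (\<lambda>T. restrict (\<lambda>s. s \<in> T) (seq f))) \<circ> g = (\<lambda>x. s \<in> g x)"
      using s by (auto simp: fun_eq_iff)
    ultimately have "continuous_map euclidean (discrete_topology UNIV) (\<lambda>x. s \<in> g x)" by simp
    then have "openin euclidean {x' \<in> topspace euclidean. (s \<in> g x') \<in> {s \<in> g x}}"
      by (rule openin_continuous_map_preimage) simp
    then have "open {x'. (s \<in> g x') = (s \<in> g x)}" by simp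
    from open_fun_nat_cylinder[OF this, of x] show ?thesis unfolding mem_Collect_eq by blast
  qed
  then have "\<forall>s\<in>seq f. \<exists>l. \<forall>x'. (\<forall>j<l. x' j = x j) \<longrightarrow> (s \<in> g x') = (s \<in> g x)" by blast
  from bchoice[OF this] obtain l where l: "\<forall>s\<in>seq f. \<forall>x'. (\<forall>j<l s. x' j = x j) \<longrightarrow> (s \<in> g x') = (s \<in> g x)" ..
  define m where "m = Max (insert 0 (l ` {s \<in> seq f. length s = L}))"
  have same: "level (g x') L = level (g x) L" if x': "\<forall>j<m. x' j = x j" for x'
  proof -
    have "(s \<in> g x') = (s \<in> g x)" if "s \<in> seq f" "length s = L" for s
    proof -
      have "l s \<le> m" unfolding m_def using that finite_seq_level[of f L] by (intro Max_ge) simp_all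
      then have "\<forall>j<l s. x' j = x j" using x' by auto
      then show ?thesis using l that(1) by blast
    qed
    moreover have "g x' \<subseteq> seq f" "g x \<subseteq> seq f" using gt by (auto simp: trees_def)
    ultimately show ?thesis unfolding level_def by (intro Collect_cong) blast
  qed
  show ?thesis by (rule exI[of _ m]) (intro allI impI, rule same)
qed

text \<open>Positivity gives \<open>h n > e * sqrt (k n)\<close> eventually, with \<open>e\<close>
  depending on the tree. The fourth root of \<open>k n\<close> is eventually below this for every
  \<open>e\<close>, so one growth rate serves all trees.\<close>

lemma sqrt_sqrt_le_of_liminf:
  fixes h k :: "nat \<Rightarrow> nat"
  assumes k: "filterlim (\<lambda>n. sqrt (sqrt (real (k n)))) at_top sequentially"
    and lim: "liminf (\<lambda>n. ereal (real (h n) / real (k n) powr (1/2))) > 0"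
  shows "\<forall>\<^sub>\<infinity>n. sqrt (sqrt (real (k n))) \<le> real (h n)"
proof -
  obtain e :: real where e: "0 < ereal e" "ereal e < liminf (\<lambda>n. ereal (real (h n) / real (k n) powr (1/2)))"
    using ereal_dense2[OF lim] by blast
  have e0: "e > 0" using e(1) by simp
  have "\<forall>\<^sub>F n in sequentially. ereal e < ereal (real (h n) / real (k n) powr (1/2))"
    using e(2) by (rule less_LiminfD)
  moreover have "\<forall>\<^sub>F n in sequentially. 1 / e \<le> sqrt (sqrt (real (k n)))"
    using k by (simp add: filterlim_at_top)
  ultimately have "\<forall>\<^sub>F n in sequentially. sqrt (sqrt (real (k n))) \<le> real (h n)"
  proof eventually_elim
    case (elim n)
    define w where "w = sqrt (sqrt (real (k n)))"
    have w: "1 / e \<le> w" using elim(2) by (simp add: w_def)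
    have w0: "w > 0" using w e0 by (meson divide_pos_pos less_le_trans zero_less_one)
    have w2: "real (k n) powr (1/2) = w * w" by (simp add: w_def powr_half_sqrt)
    have "e * (w * w) < real (h n)" using elim(1) w0 unfolding w2 by (simp add: field_simps)
    moreover have "w \<le> e * (w * w)"
    proof -
      have "1 \<le> e * w" using w e0 by (simp add: field_simps)
      then have "1 * w \<le> (e * w) * w" using w0 by (intro mult_right_mono) auto
      then show ?thesis by (simp add: mult_ac)
    qed
    ultimately show ?case unfolding w_def by linarith
  qed
  then show ?thesis by (simp add: cofinite_eq_sequentially)
qed

theorem theorem7p1:
  fixes f :: "nat \<Rightarrow> nat" and \<A> :: "nat list set set"
  assumes conjecture:
      "\<And>(k :: nat \<Rightarrow> nat) (t :: nat \<Rightarrow> real).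
         (\<forall>m. k m > 0) \<Longrightarrow> (\<forall>m. t m > 0) \<Longrightarrow>
         (\<lambda>m. real (k m) / real m) \<longlonglongrightarrow> 0 \<Longrightarrow>
         filterlim k at_top sequentially \<Longrightarrow>
         filterlim (\<lambda>m. t m / sqrt (real (k m))) at_top sequentially \<Longrightarrow>
         (\<lambda>m. sqrt (real (N1 (2 * m) m (k m) (t m))) / real ((2 * m) choose m)) \<longlonglongrightarrow> 0"
    and f: "\<forall>n. f n \<ge> 2"
    and subset: "\<A> \<subseteq> trees f"
    and analytic: "analytic_in (tree_topology f) \<A>"
    and branching: "\<forall>T\<in>\<A>. infinitely_branching T"
    and wd: "weakly_distributive \<A>"
    and ccc: "ccc \<A>"
    and decay: "bounded_branching_decay \<A>"
  shows "\<exists>c \<in> seq f \<rightarrow> {0, 1}. \<exists>T\<in>\<A>. \<forall>S\<in>\<A>. S \<subseteq> T \<longrightarrow>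
           (\<forall>\<^sub>\<infinity>n. \<not> homogeneous c (level S n))"
proof (rule ccontr)
  assume contra: "\<not> ?thesis"
  obtain T where T: "T \<in> \<A>" "\<And>S \<alpha>. S \<in> \<A> \<Longrightarrow> S \<subseteq> T \<Longrightarrow> 0 < \<alpha> \<Longrightarrow> \<alpha> < 1 \<Longrightarrow>
      liminf (\<lambda>n. ereal (real (height_fun S n) / real (height_fun T n) powr \<alpha>)) > 0"
    using decay unfolding bounded_branching_decay_def by auto
  obtain g :: "(nat \<Rightarrow> nat) \<Rightarrow> nat list set" where g: "continuous_map euclidean (tree_topology f) g" "range g = \<A>"
    using analytic T(1) by (auto simp: analytic_in_def)
  have T_tree: "T \<in> trees f" and T_branching: "infinitely_branching T" using T(1) subset branching by auto
  have "filterlim (\<lambda>n. real (height_fun T n)) at_top sequentially"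
    unfolding filterlim_at_top
  proof
    fix Z :: real
    obtain k :: nat where k: "Z \<le> real k" using real_arch_simple by blast
    have "\<forall>\<^sub>F n in sequentially. k \<le> card (core T n)"
      using eventually_card_core_ge[OF T_tree T_branching] by (simp add: cofinite_eq_sequentially)
    then show "\<forall>\<^sub>F n in sequentially. Z \<le> real (height_fun T n)"
    proof eventually_elim
      case (elim n)
      have "card (core T n) \<le> height_fun T n"
        unfolding height_fun_def by (intro card_mono finite_level[OF T_tree] core_subset_level)
      then show ?case using k elim by linarith
    qed
  qed
  then have top: "filterlim (\<lambda>n. sqrt (sqrt (real (height_fun T n)))) at_top sequentially"
    by (intro filterlim_compose[OF sqrt_at_top])
  interpret bad_family f \<A> T g "\<lambda>n. sqrt (sqrt (real (height_fun T n)))"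
  proof
    show "\<exists>S\<in>\<A>. S \<subseteq> T' \<and> (\<exists>\<^sub>\<infinity>n. homogeneous c (level S n))" if "c \<in> seq f \<rightarrow> {0, 1}" "T' \<in> \<A>" for c T'
      using contra that unfolding not_eventually not_not Bex_def Ball_def by (auto simp: not_eventually)
    show "\<forall>\<^sub>\<infinity>n. sqrt (sqrt (real (height_fun T n))) \<le> real (card (level S n))" if "S \<in> \<A>" "S \<subseteq> T" for S
      using sqrt_sqrt_le_of_liminf[OF top T(2)[OF that, of "1/2"]] by (simp add: height_fun_def)
    show "\<exists>l. \<forall>x'. (\<forall>j<l. x' j = x j) \<longrightarrow> level (g x') L = level (g x) L" for x L
      by (rule level_locally_constant_of_continuous[OF g(1)])
  qed (use subset T(1) branching ccc g(2) top in simp_all)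
  show False by (rule impossible)
qed

end
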